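(* Let $m\ge 0$ be an integer and let $\Lambda$ be the form $$\Lambda(a_1,\dots,a_{4m+2})=\int_{\mathbf{C}^{2m+1}}\prod_{j=1}^{4m+2}a_j(f_j\cdot x)\,dx,$$ where $e_1,\dots,e_{2m+1}$ is the standard basis of $\mathbf{R}^{2m+1}$ and $f_{2j-1}=e_j$ for $j=1,\dots,2m+1$, $f_{2j}=e_j-e_{j+1}$ for $j=1,\dots,2m$, and $f_{4m+2}=e_1-e_2+\cdots+e_{2m+1}$. Let $0<\delta\le 1/10$, let $\theta$ lie in the interior of $P_\delta$, and let the Lorentz indices $q_1,\dots,q_{4m}\in(0,\infty]$ satisfy $\sum_{j=1}^4 1/q_{4k+j}\ge 1$ for $k=0,\dots,m-1$. Then there is a constant $c=c_\theta$, depending only on $\max\{1/(1/10-|\theta_i-1/2|): i=1,\dots,4m+2\}$ (in particular, not otherwise on $m$), such that $$|\Lambda(a_1,\dots,a_{4m+2})|\le c^{m}\,\|a_{4m+1}\|_{\theta_{4m+1}}\|a_{4m+2}\|_{\theta_{4m+2}}\prod_{j=0}^{m-1}\Big(\|a_{4j+1}\|_{\theta_{4j+1},q_{4j+1}}\|a_{4j+2}\|_{\theta_{4j+2},q_{4j+2}}\|a_{4j+3}\|_{\theta_{4j+3},q_{4j+3}}\|a_{4j+4}\|_{\theta_{4j+4},q_{4j+4}}\Big)$$ for all functions $a_1,\dots,a_{4m+2}$ on $\mathbf{C}$ for which the norms on the right are finite.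
   Context: For $x=(x_1,\dots,x_{2m+1})\in\mathbf{C}^{2m+1}$ and $f=(f^1,\dots,f^{2m+1})\in\mathbf{R}^{2m+1}$, $f\cdot x=\sum_i f^i x_i\in\mathbf{C}$; $dx$ is Lebesgue measure, with $\mathbf{C}$ identified with $\mathbf{R}^2$. $\|a\|_{\theta}$ denotes the norm in $L^{1/\theta}(\mathbf{C})$ and $\|a\|_{\theta,q}$ the (quasi-)norm in the Lorentz space $L^{1/\theta,q}(\mathbf{C})$, i.e. $\|a\|_{\theta,q}=\left(\int_0^\infty (s^{\theta}a^*(s))^q\,\frac{ds}{s}\right)^{1/q}$ for $q<\infty$ and $\sup_{s>0}s^{\theta}a^*(s)$ for $q=\infty$, where $a^*$ is the decreasing rearrangement of $|a|$. For $\delta>0$, $$P_\delta=\Big\{\theta\in\mathbf{R}^{4m+2}: \sum_{i=4j+1}^{4j+4}\theta_i=2 \text{ for } j=0,\dots,m-1,\ \theta_{4m+1}+\theta_{4m+2}=1,\ |\theta_i-1/2|\le\delta \text{ for } i=1,\dots,4m+2\Big\}.$$ The interior of $P_\delta$ is taken relative to the affine subspace defined by the equalities, so it consists of the $\theta\in P_\delta$ with $|\theta_i-1/2|<\delta$ for all $i$. *)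

theory Defs
  imports "HOL-Analysis.Analysis"
begin

text \<open>Vectors of length \<open>n\<close> (real or complex) are functions on \<open>nat\<close>, of which only the entries
  with index in \<open>{1..n}\<close> are used. This lets the dimension be a term, so that a constant can be
  quantified before it.\<close>

definition std_basis :: "nat \<Rightarrow> nat \<Rightarrow> real" where
  "std_basis i = (\<lambda>k. if k = i then 1 else 0)"

definition fvec :: "nat \<Rightarrow> nat \<Rightarrow> nat \<Rightarrow> real" where
  "fvec m j =
     (if j = 4 * m + 2 then (\<lambda>k. \<Sum>i=1..2 * m + 1. (- 1) ^ (i + 1) * std_basis i k)
      else if odd j then std_basis ((j + 1) div 2)
      else (\<lambda>k. std_basis (j div 2) k - std_basis (j div 2 + 1) k))"

definition dotc :: "nat \<Rightarrow> (nat \<Rightarrow> real) \<Rightarrow> (nat \<Rightarrow> complex) \<Rightarrow> complex" where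
  "dotc n f x = (\<Sum>i=1..n. of_real (f i) * x i)"

text \<open>Lebesgue measure on the space of \<open>n\<close>-tuples of complex numbers. It is completed because the
  functions \<open>a\<^sub>j\<close> below are only assumed Lebesgue measurable.\<close>

definition lebesgue_Cn :: "nat \<Rightarrow> (nat \<Rightarrow> complex) measure" where
  "lebesgue_Cn n = completion (Pi\<^sub>M {1..n} (\<lambda>_. lborel))"

definition Lambda_integrand :: "nat \<Rightarrow> (nat \<Rightarrow> complex \<Rightarrow> complex) \<Rightarrow> (nat \<Rightarrow> complex) \<Rightarrow> complex" where
  "Lambda_integrand m a x = (\<Prod>j=1..4 * m + 2. a j (dotc (2 * m + 1) (fvec m j) x))"

definition Lambda_form :: "nat \<Rightarrow> (nat \<Rightarrow> complex \<Rightarrow> complex) \<Rightarrow> complex" where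
  "Lambda_form m a = (LINT x|lebesgue_Cn (2 * m + 1). Lambda_integrand m a x)"

text \<open>Powers with a positive real exponent on \<open>[0, \<infinity>]\<close>.\<close>

definition ennpowr :: "ennreal \<Rightarrow> real \<Rightarrow> ennreal" where
  "ennpowr x p = (if x = \<infinity> then \<infinity> else ennreal (enn2real x powr p))"

text \<open>The norm of \<open>L\<^bsup>1/\<theta>\<^esup>\<close>; the formula is meant for \<open>0 < \<theta>\<close> (so not for \<open>L\<^bsup>\<infinity>\<^esup>\<close>).\<close>

definition L_norm :: "real \<Rightarrow> (complex \<Rightarrow> complex) \<Rightarrow> ennreal" where
  "L_norm \<theta> a = ennpowr (\<integral>\<^sup>+z. ennreal (cmod (a z) powr (1 / \<theta>)) \<partial>lebesgue) \<theta>"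

definition decr_rearrangement :: "(complex \<Rightarrow> complex) \<Rightarrow> real \<Rightarrow> ennreal" where
  "decr_rearrangement a s =
     Inf {ennreal t |t. 0 \<le> t \<and> emeasure lebesgue {z. t < cmod (a z)} \<le> ennreal s}"

definition lorentz_norm :: "real \<Rightarrow> ennreal \<Rightarrow> (complex \<Rightarrow> complex) \<Rightarrow> ennreal" where
  "lorentz_norm \<theta> q a =
     (if q = \<infinity> then (SUP s\<in>{0<..}. ennreal (s powr \<theta>) * decr_rearrangement a s)
      else ennpowr
        (\<integral>\<^sup>+s\<in>{0<..}. (ennpowr (ennreal (s powr \<theta>) * decr_rearrangement a s) (enn2real q)
            * ennreal (1 / s)) \<partial>lborel)
        (1 / enn2real q))"

definition P_affine :: "nat \<Rightarrow> (nat \<Rightarrow> real) set" where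
  "P_affine m =
     {\<theta> \<in> {1..4 * m + 2} \<rightarrow>\<^sub>E UNIV.
        (\<forall>j<m. (\<Sum>i=4 * j + 1..4 * j + 4. \<theta> i) = 2) \<and> \<theta> (4 * m + 1) + \<theta> (4 * m + 2) = 1}"

definition P_set :: "nat \<Rightarrow> real \<Rightarrow> (nat \<Rightarrow> real) set" where
  "P_set m \<delta> = {\<theta> \<in> P_affine m. \<forall>i\<in>{1..4 * m + 2}. \<bar>\<theta> i - 1 / 2\<bar> \<le> \<delta>}"

definition P_interior :: "nat \<Rightarrow> real \<Rightarrow> (nat \<Rightarrow> real) set" where
  "P_interior m \<delta> =
     (subtopology (powertop_real {1..4 * m + 2}) (P_affine m)) interior_of (P_set m \<delta>)"

lemma P_interior_eq:
  "P_interior m \<delta> = {\<theta> \<in> P_affine m. \<forall>i\<in>{1..4 * m + 2}. \<bar>\<theta> i - 1 / 2\<bar> < \<delta>}"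
proof (intro set_eqI iffI)
  fix \<theta>
  let ?I = "{1..4 * m + 2}"
  assume "\<theta> \<in> {\<theta> \<in> P_affine m. \<forall>i\<in>?I. \<bar>\<theta> i - 1 / 2\<bar> < \<delta>}"
  then have A: "\<theta> \<in> P_affine m" and lt: "\<And>i. i \<in> ?I \<Longrightarrow> \<bar>\<theta> i - 1 / 2\<bar> < \<delta>" by auto
  define U where "U = (PiE ?I (\<lambda>_. {1/2 - \<delta><..<1/2 + \<delta>}))"
  have "openin (powertop_real ?I) U"
    unfolding U_def by (subst openin_PiE) (auto simp: openin_PiE_gen)
  then have op: "openin (subtopology (powertop_real ?I) (P_affine m)) (U \<inter> P_affine m)"
    by (auto simp: openin_subtopology)
  have "\<theta> \<in> U"
    unfolding U_def PiE_iff
  proof (intro conjI ballI)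
    fix i assume "i \<in> ?I"
    from lt[OF this] show "\<theta> i \<in> {1/2 - \<delta><..<1/2 + \<delta>}"
      unfolding greaterThanLessThan_iff by linarith
  next
    show "\<theta> \<in> extensional ?I" using A unfolding P_affine_def PiE_iff by blast
  qed
  moreover have "U \<inter> P_affine m \<subseteq> P_set m \<delta>"
  proof
    fix \<eta> assume \<eta>: "\<eta> \<in> U \<inter> P_affine m"
    have "\<bar>\<eta> i - 1 / 2\<bar> \<le> \<delta>" if "i \<in> ?I" for i
    proof -
      have "\<eta> i \<in> {1/2 - \<delta><..<1/2 + \<delta>}" using \<eta> that unfolding U_def PiE_iff by blast
      then show ?thesis unfolding greaterThanLessThan_iff by linarith
    qed
    then show "\<eta> \<in> P_set m \<delta>" using \<eta> unfolding P_set_def by blast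
  qed
  ultimately show "\<theta> \<in> P_interior m \<delta>"
    unfolding P_interior_def interior_of_def using op A by (intro CollectI exI[of _ "U \<inter> P_affine m"]) blast
next
  fix \<theta>
  let ?I = "{1..4 * m + 2}"
  assume "\<theta> \<in> P_interior m \<delta>"
  then obtain U where U: "openin (powertop_real ?I) U" "\<theta> \<in> U" "U \<inter> P_affine m \<subseteq> P_set m \<delta>"
    and A: "\<theta> \<in> P_affine m"
    unfolding P_interior_def interior_of_def openin_subtopology by blast
  have "\<bar>\<theta> i - 1 / 2\<bar> < \<delta>" if i: "i \<in> ?I" for i
  proof -
    define b where "b = (i - 1) div 4"
    obtain k where k: "k \<in> ?I" "k \<noteq> i" "(k - 1) div 4 = b"
    proof (cases "odd i")
      case True
      then obtain r where r: "i = 2 * r + 1" by (elim oddE)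
      have "(i + 1 - 1) div 4 = (i - 1) div 4"
        unfolding r using div_mult2_eq[of _ 2 2] by simp
      moreover have "i + 1 \<in> ?I" using i unfolding r by simp
      ultimately show ?thesis using that[of "i + 1"] unfolding b_def by simp
    next
      case False
      then obtain r where r: "i = 2 * r" by (auto elim: evenE)
      with i obtain r' where r': "i = 2 * r' + 2" by (cases r) auto
      have "(i - 1 - 1) div 4 = (i - 1) div 4"
        unfolding r' using div_mult2_eq[of _ 2 2] by simp
      moreover have "i - 1 \<in> ?I" using i unfolding r' by simp
      ultimately show ?thesis using that[of "i - 1"] r' unfolding b_def by simp
    qed
    define d :: "nat \<Rightarrow> real" where "d = (\<lambda>l. (if l = i then 1 else 0) - (if l = k then 1 else 0))"
    define g where "g = (\<lambda>t. \<lambda>l\<in>?I. \<theta> l + t * d l)"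
    have blk: "n \<in> {4 * j + 1..4 * j + 4} \<longleftrightarrow> (n - 1) div 4 = j" if n: "n \<in> ?I" for n j
    proof -
      obtain r where r: "n = Suc r" using n by (cases n) auto
      obtain u v where uv: "r = 4 * u + v" "v < 4" "r div 4 = u"
        using mult_div_mod_eq[of 4 r] mod_less_divisor[of 4 r] by (metis zero_less_numeral)
      have "4 * j + 1 \<le> n \<and> n \<le> 4 * j + 4 \<longleftrightarrow> u = j" using r uv(1,2) by linarith
      then show ?thesis using r uv(3) by simp
    qed
    have dsum: "(\<Sum>l=4 * j + 1..4 * j + 4. d l) = 0" for j
      unfolding d_def sum_subtractf
      using blk[OF i, of j] blk[OF k(1), of j] k(3) b_def
      by (simp add: sum.delta)
    have i2: "i = 4 * m + 1 \<or> i = 4 * m + 2 \<longleftrightarrow> b = m"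
      using blk[OF i, of m] i unfolding b_def atLeastAtMost_iff by linarith
    have k2: "k = 4 * m + 1 \<or> k = 4 * m + 2 \<longleftrightarrow> b = m"
      using blk[OF k(1), of m] k(1,3) unfolding atLeastAtMost_iff by linarith
    have dlast: "d (4 * m + 1) + d (4 * m + 2) = 0"
      unfolding d_def using i2 k2 k(2) by (cases "b = m") auto
    have gA: "g t \<in> P_affine m" for t
    proof -
      have "(\<Sum>l=4 * j + 1..4 * j + 4. g t l) = 2" if "j < m" for j
      proof -
        have "(\<Sum>l=4 * j + 1..4 * j + 4. g t l) = (\<Sum>l=4 * j + 1..4 * j + 4. \<theta> l + t * d l)"
          unfolding g_def using that by (intro sum.cong) auto
        also have "\<dots> = (\<Sum>l=4 * j + 1..4 * j + 4. \<theta> l) + t * (\<Sum>l=4 * j + 1..4 * j + 4. d l)"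
          by (simp only: sum.distrib sum_distrib_left)
        also have "\<dots> = 2" using A that dsum[of j] unfolding P_affine_def by auto
        finally show ?thesis .
      qed
      moreover have "g t (4 * m + 1) + g t (4 * m + 2)
          = \<theta> (4 * m + 1) + \<theta> (4 * m + 2) + t * (d (4 * m + 1) + d (4 * m + 2))"
        unfolding g_def by (simp add: algebra_simps)
      ultimately show ?thesis
        using A dlast unfolding P_affine_def by (auto simp: g_def)
    qed
    have "continuous_map euclideanreal (powertop_real ?I) g"
      unfolding g_def
      by (auto simp: continuous_map_componentwise intro!: continuous_intros)
    then have "openin euclideanreal {t \<in> topspace euclideanreal. g t \<in> U}"
      using U(1) by (rule openin_continuous_map_preimage)
    then have "open {t. g t \<in> U}" by simp
    moreover have "g 0 = \<theta>"
      using A unfolding P_affine_def g_def by (auto simp: PiE_iff extensional_restrict)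
    then have "0 \<in> {t. g t \<in> U}" using U(2) by simp
    ultimately obtain e where e: "e > 0" "ball 0 e \<subseteq> {t. g t \<in> U}"
      using open_contains_ball by blast
    then have "e / 2 \<in> ball 0 e" "- e / 2 \<in> ball 0 e" by (auto simp: dist_real_def)
    then have "g (e / 2) \<in> U" "g (- e / 2) \<in> U" using e(2) by blast+
    then have "g (e / 2) \<in> P_set m \<delta>" "g (- e / 2) \<in> P_set m \<delta>" using U(3) gA by auto
    then have "\<bar>g (e / 2) i - 1 / 2\<bar> \<le> \<delta>" "\<bar>g (- e / 2) i - 1 / 2\<bar> \<le> \<delta>"
      using i unfolding P_set_def by blast+
    moreover have gi: "g t i = \<theta> i + t" for t
      using i k(2) unfolding g_def d_def by simp
    ultimately show ?thesis using e(1) unfolding gi by linarith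
  qed
  then show "\<theta> \<in> {\<theta> \<in> P_affine m. \<forall>i\<in>?I. \<bar>\<theta> i - 1 / 2\<bar> < \<delta>}" using A by auto
qed

end

theory Submission
  imports Defs
begin

text \<open>
  The vectors \<open>e\<^sub>i\<close> and \<open>e\<^sub>i - e\<^sub>i\<^sub>+\<^sub>1\<close> are the edges of a fan: spokes joining the vertices
  \<open>1, \<dots>, 2m+1\<close> of a path to a hub (where the coordinate is \<open>0\<close>), and the edges of the path. A block
  consists of the four edges \<open>x\<close>, \<open>x - u\<close>, \<open>u\<close>, \<open>u - x'\<close> between the consecutive coordinates \<open>x, u, x'\<close>.
  Besides the blocks there are two more functions, of the last spoke \<open>x\<^sub>2\<^sub>m\<^sub>+\<^sub>1\<close> and of the alternating sum.

  Suppose first that the functions in the blocks are indicators of sets of finite measure. Keep two of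
  the four indicators in each block and replace the others by \<open>1\<close>. If the kept edges together with one of
  the two extra vectors form a basis, then the integral is at most the product of the kept measures times
  the integral of the extra function. Three families of choices suffice, in each of which the pairs kept
  in different blocks are independent of each other: with the last spoke, any pair except \<open>{u, u - x'}\<close>;
  with the alternating sum, any pair except \<open>{x, u - x'}\<close> and \<open>{u, u - x'}\<close>; and with the alternating sum,
  either of the pairs \<open>{x - u, u - x'}\<close> and \<open>{u, u - x'}\<close>. So each family bounds the integral by a product
  over the blocks of a minimum of products of two measures (\<open>chain_form_fst_le\<close>,
  \<open>chain_form_forward_le\<close>, \<open>chain_form_backward_le\<close>). Hoelder's inequality between the two extra functions,
  with exponents \<open>v + w = 1\<close>, weights the three bounds by \<open>v\<close>, \<open>w - 1/5\<close> and \<open>1/5\<close>. If the measures in a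
  block are \<open>exp n\<^sub>1, \<dots>, exp n\<^sub>4\<close>, the weighted bound is at most \<open>exp (\<Sum>i. \<theta>\<^sub>i n\<^sub>i - \<epsilon> spread n)\<close> whenever
  \<open>\<bar>\<theta>\<^sub>i - 1/2\<bar> + \<epsilon> \<le> 1/10\<close> (\<open>exponent_gain\<close>). This is an elementary inequality in the exponents, and
  it is where the number \<open>1/10\<close> comes from.

  The factor \<open>exp (- \<epsilon> spread n)\<close> makes it possible to sum over level sets. Every function in a block is
  dominated by \<open>\<Sum>n. a\<^sup>* (exp n) 1\<^sub>E\<^sub>n\<close> with \<open>\<bar>E\<^sub>n\<bar> \<le> exp (n + 1)\<close> (\<open>level_decomposition\<close>), and the
  \<open>\<ell>\<^sup>q\<close> quasi-norm of \<open>exp (n \<theta>) a\<^sup>* (exp n)\<close> is controlled by the Lorentz quasi-norm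
  (\<open>sampled_normalised\<close>). Since the bound for indicators is a product over the blocks, the sum over all
  choices of level sets is a product of sums belonging to single blocks, and this gives the \<open>m\<close>-th power
  of one constant. In one block, \<open>\<Sum> exp (- \<epsilon> spread n) b\<^sub>1(n\<^sub>1) b\<^sub>2(n\<^sub>2) b\<^sub>3(n\<^sub>3) b\<^sub>4(n\<^sub>4)\<close> is a geometric
  series of diagonal sums, and \<open>\<Sum> 1/q\<^sub>i \<ge> 1\<close> bounds each of these by the product of the \<open>\<ell>\<^sup>q\<close> quasi-norms
  (\<open>sum_prod_shift_le_1\<close>).
\<close>

section \<open>Lebesgue measure and iterated integrals\<close>

lemma nn_integral_lborel_translate:
  fixes f :: "'a::euclidean_space \<Rightarrow> ennreal"
  assumes [measurable]: "f \<in> borel_measurable borel"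
  shows "(\<integral>\<^sup>+x. f (x + c) \<partial>lborel) = (\<integral>\<^sup>+x. f x \<partial>lborel)"
proof -
  have "(\<integral>\<^sup>+x. f x \<partial>lborel) = (\<integral>\<^sup>+x. f x \<partial>distr lborel borel ((+) c))"
    by (simp add: lborel_distr_plus)
  also have "\<dots> = (\<integral>\<^sup>+x. f (x + c) \<partial>lborel)"
    by (subst nn_integral_distr) (auto simp: add.commute)
  finally show ?thesis ..
qed

lemma nn_integral_lborel_reflect:
  fixes f :: "'a::euclidean_space \<Rightarrow> ennreal"
  assumes [measurable]: "f \<in> borel_measurable borel"
  shows "(\<integral>\<^sup>+x. f (c - x) \<partial>lborel) = (\<integral>\<^sup>+x. f x \<partial>lborel)"
proof -
  have "(\<integral>\<^sup>+x. f x \<partial>lborel)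
      = (\<integral>\<^sup>+x. f x \<partial>density (distr lborel borel (\<lambda>x::'a. c + (-1) *\<^sub>R x)) (\<lambda>_. ennreal (\<bar>-1\<bar>^DIM('a))))"
    by (subst lborel_affine[of "-1" c]) auto
  also have "\<dots> = (\<integral>\<^sup>+x. f (c - x) \<partial>lborel)"
    by (simp add: nn_integral_density nn_integral_distr)
  finally show ?thesis ..
qed

lemma iterated_integral_cmult:
  fixes h :: "complex \<times> complex \<Rightarrow> ennreal"
  assumes h: "h \<in> borel_measurable (borel \<Otimes>\<^sub>M borel)"
  shows "(\<integral>\<^sup>+u. \<integral>\<^sup>+v. c * h (u, v) \<partial>lborel \<partial>lborel) = c * (\<integral>\<^sup>+u. \<integral>\<^sup>+v. h (u, v) \<partial>lborel \<partial>lborel)"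
proof -
  have [measurable]: "h \<in> borel_measurable (lborel \<Otimes>\<^sub>M lborel)"
    using h by (simp cong: measurable_cong_sets sets_pair_measure_cong)
  have "(\<lambda>u. \<integral>\<^sup>+v. h (u, v) \<partial>lborel) \<in> borel_measurable lborel" by measurable
  moreover have "(\<lambda>v. h (u, v)) \<in> borel_measurable lborel" for u by measurable
  ultimately show ?thesis by (simp add: nn_integral_cmult)
qed

lemma coordinate_borel:
  fixes i :: 'i
  shows "i \<in> I \<Longrightarrow> (\<lambda>x. x i) \<in> borel_measurable (Pi\<^sub>M I (\<lambda>_. lborel :: complex measure))"
  using measurable_component_singleton[of i I "\<lambda>_. lborel :: complex measure"] by simp

section \<open>Chains of blocks\<close>

text \<open>The four edges of a block, in the order in which the functions \<open>a\<^sub>4\<^sub>k\<^sub>+\<^sub>1, \<dots>, a\<^sub>4\<^sub>k\<^sub>+\<^sub>4\<close> occur; here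
  \<open>x, u, x'\<close> stand for \<open>x\<^sub>2\<^sub>k\<^sub>+\<^sub>1, x\<^sub>2\<^sub>k\<^sub>+\<^sub>2, x\<^sub>2\<^sub>k\<^sub>+\<^sub>3\<close>.\<close>

definition block :: "(nat \<Rightarrow> complex set) \<Rightarrow> complex \<Rightarrow> complex \<Rightarrow> complex \<Rightarrow> ennreal" where
  "block F x u x' =
     indicator (F 1) x * indicator (F 2) (x - u) * indicator (F 3) u * indicator (F 4) (u - x')"

definition alt_sum :: "nat \<Rightarrow> (nat \<Rightarrow> complex) \<Rightarrow> complex" where
  "alt_sum n x = (\<Sum>i=1..n. (- 1) ^ (i + 1) * x i)"

text \<open>The form on indicator functions. The last two functions are merged into one function \<open>\<gamma>\<close> of the last
  coordinate and of the alternating sum, because integrating out a block turns a product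
  \<open>\<alpha> x * \<beta> t\<close> into a function of \<open>(x, t)\<close> that is not a product any more.\<close>

definition chain_form ::
  "nat \<Rightarrow> (nat \<Rightarrow> nat \<Rightarrow> complex set) \<Rightarrow> (complex \<Rightarrow> complex \<Rightarrow> ennreal) \<Rightarrow> ennreal" where
  "chain_form m F \<gamma> = (\<integral>\<^sup>+x. (\<Prod>k<m. block (F k) (x (2*k+1)) (x (2*k+2)) (x (2*k+3)))
      * \<gamma> (x (2*m+1)) (alt_sum (2*m+1) x) \<partial>Pi\<^sub>M {1..2*m+1} (\<lambda>_. lborel))"

text \<open>The result of integrating out the last block: a shorter chain ends at \<open>x\<close> with alternating sum \<open>t\<close>,
  and the longer one ends at \<open>x'\<close>, where the alternating sum is \<open>t - u + x'\<close>.\<close>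

definition absorb ::
  "(nat \<Rightarrow> complex set) \<Rightarrow> (complex \<Rightarrow> complex \<Rightarrow> ennreal) \<Rightarrow> complex \<Rightarrow> complex \<Rightarrow> ennreal" where
  "absorb F \<gamma> x t = (\<integral>\<^sup>+u. \<integral>\<^sup>+x'. block F x u x' * \<gamma> x' (t - u + x') \<partial>lborel \<partial>lborel)"

abbreviation plane_measurable :: "(complex \<Rightarrow> complex \<Rightarrow> ennreal) \<Rightarrow> bool" where
  "plane_measurable \<gamma> \<equiv> (\<lambda>(x, t). \<gamma> x t) \<in> borel_measurable (borel \<Otimes>\<^sub>M borel)"

abbreviation borel_block :: "(nat \<Rightarrow> complex set) \<Rightarrow> bool" where
  "borel_block F \<equiv> (\<forall>i. F i \<in> sets borel)"

lemma measurable_plane_comp: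
  assumes g: "plane_measurable \<gamma>" and [measurable]: "a \<in> borel_measurable M" "b \<in> borel_measurable M"
  shows "(\<lambda>x. \<gamma> (a x) (b x)) \<in> borel_measurable M"
  using measurable_compose[OF _ g, of "\<lambda>x. (a x, b x)" M] by simp

lemma measurable_block [measurable (raw)]:
  assumes "borel_block F"
    and [measurable]: "a \<in> borel_measurable M" "b \<in> borel_measurable M" "c \<in> borel_measurable M"
  shows "(\<lambda>x. block F (a x) (b x) (c x)) \<in> borel_measurable M"
proof -
  have [measurable]: "F i \<in> sets borel" for i using assms by auto
  show ?thesis unfolding block_def by measurable
qed

lemma measurable_absorb:
  assumes g: "plane_measurable \<gamma>" and F: "borel_block F"
  shows "plane_measurable (absorb F \<gamma>)"
  unfolding absorb_def case_prod_beta
  by (measurable, rule F, measurable, rule measurable_plane_comp[OF g]) measurable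

lemma alt_sum_cong: "(\<And>i. i \<in> {1..n} \<Longrightarrow> x i = y i) \<Longrightarrow> alt_sum n x = alt_sum n y"
  unfolding alt_sum_def by (intro sum.cong) auto

lemma alt_sum_two_more: "alt_sum (2*m+3) x = alt_sum (2*m+1) x - x (2*m+2) + x (2*m+3)"
  by (simp add: alt_sum_def numeral_3_eq_3)

lemma measurable_alt_sum [measurable]:
  "{1..n} \<subseteq> I \<Longrightarrow> alt_sum n \<in> borel_measurable (Pi\<^sub>M I (\<lambda>_. lborel))"
  unfolding alt_sum_def by (intro borel_measurable_sum borel_measurable_times) (auto intro: coordinate_borel)

text \<open>Fubini: only the last block and \<open>\<gamma>\<close> involve the last two coordinates. All bounds for chains are
  obtained from this by induction on \<open>m\<close> with \<open>\<gamma>\<close> arbitrary.\<close>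

lemma chain_form_Suc:
  assumes g: "plane_measurable \<gamma>" and F: "\<And>k. borel_block (F k)"
  shows "chain_form (Suc m) F \<gamma> = chain_form m F (absorb (F m) \<gamma>)"
proof -
  interpret product_sigma_finite "\<lambda>_::nat. lborel :: complex measure" ..
  let ?I = "{1..2*m+1}"
  let ?P = "\<lambda>x. \<Prod>k<m. block (F k) (x (2*k+1)) (x (2*k+2)) (x (2*k+3))"
  let ?f = "\<lambda>x. (\<Prod>k<Suc m. block (F k) (x (2*k+1)) (x (2*k+2)) (x (2*k+3)))
      * \<gamma> (x (2*m+3)) (alt_sum (2*m+3) x)"
  have eqI: "{1..2*Suc m+1} = insert (2*m+3) (insert (2*m+2) ?I)" by auto
  have meas: "?f \<in> borel_measurable (Pi\<^sub>M (insert (2*m+3) (insert (2*m+2) ?I)) (\<lambda>_. lborel))"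
    by (intro borel_measurable_times_ennreal borel_measurable_prod_ennreal measurable_block[OF F]
        measurable_plane_comp[OF g] measurable_alt_sum) (auto intro: coordinate_borel)
  have "chain_form (Suc m) F \<gamma> = (\<integral>\<^sup>+x. ?f x \<partial>Pi\<^sub>M (insert (2*m+3) (insert (2*m+2) ?I)) (\<lambda>_. lborel))"
    unfolding chain_form_def eqI by (simp add: numeral_3_eq_3)
  also have "\<dots> = (\<integral>\<^sup>+x. \<integral>\<^sup>+u. \<integral>\<^sup>+x'. ?f (x(2*m+2 := u, 2*m+3 := x')) \<partial>lborel \<partial>lborel \<partial>Pi\<^sub>M ?I (\<lambda>_. lborel))"
    apply (subst product_nn_integral_insert[OF _ _ meas], simp, simp)
    apply (subst product_nn_integral_insert, simp, simp)
     apply (rule lborel.borel_measurable_nn_integral)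
    subgoal
      using measurable_compose[OF measurable_add_dim meas] by (simp add: case_prod_beta)
    apply simp
    done
  also have "\<dots> = (\<integral>\<^sup>+x. ?P x * absorb (F m) \<gamma> (x (2*m+1)) (alt_sum (2*m+1) x) \<partial>Pi\<^sub>M ?I (\<lambda>_. lborel))"
  proof (intro nn_integral_cong)
    fix x
    have "?f (x(2*m+2 := u, 2*m+3 := x'))
      = ?P x * (block (F m) (x (2*m+1)) u x' * \<gamma> x' (alt_sum (2*m+1) x - u + x'))" for u x'
    proof -
      let ?y = "x(2*m+2 := u, 2*m+3 := x')"
      have "alt_sum (2*m+1) ?y = alt_sum (2*m+1) x" by (intro alt_sum_cong) auto
      moreover have "?P ?y = ?P x" by (intro prod.cong refl) auto
      ultimately show ?thesis
        unfolding alt_sum_two_more by (simp add: mult.assoc)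
    qed
    moreover have "(\<lambda>p. block (F m) (x (2*m+1)) (fst p) (snd p)
        * \<gamma> (snd p) (alt_sum (2*m+1) x - fst p + snd p)) \<in> borel_measurable (borel \<Otimes>\<^sub>M borel)"
      by (intro borel_measurable_times_ennreal measurable_block[OF F] measurable_plane_comp[OF g]) auto
    note iterated_integral_cmult[OF this, of "?P x"]
    ultimately show "(\<integral>\<^sup>+u. \<integral>\<^sup>+x'. ?f (x(2*m+2 := u, 2*m+3 := x')) \<partial>lborel \<partial>lborel)
      = ?P x * absorb (F m) \<gamma> (x (2*m+1)) (alt_sum (2*m+1) x)"
      unfolding absorb_def by simp
  qed
  finally show ?thesis unfolding chain_form_def .
qed

section \<open>Absorbing one block\<close>

lemma swap_integrals:
  assumes "(\<lambda>(x, y). f x y) \<in> borel_measurable (borel \<Otimes>\<^sub>M borel)"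
  shows "(\<integral>\<^sup>+x. \<integral>\<^sup>+y. f x y \<partial>lborel \<partial>lborel) = (\<integral>\<^sup>+y. \<integral>\<^sup>+x. f x (y::complex) \<partial>lborel \<partial>(lborel :: complex measure))"
proof -
  have "(\<lambda>(x, y). f x y) \<in> borel_measurable (lborel \<Otimes>\<^sub>M lborel)"
    using assms by (simp cong: measurable_cong_sets sets_pair_measure_cong)
  from lborel_pair.Fubini'[OF this] show ?thesis ..
qed

lemma block_le_pair:
  "block F x u x' \<le> indicator (F 1) x * indicator (F 2) (x - u)"
  "block F x u x' \<le> indicator (F 1) x * indicator (F 3) u"
  "block F x u x' \<le> indicator (F 2) (x - u) * indicator (F 3) u"
  "block F x u x' \<le> indicator (F 1) x * indicator (F 4) (u - x')"
  "block F x u x' \<le> indicator (F 2) (x - u) * indicator (F 4) (u - x')"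
  "block F x u x' \<le> indicator (F 3) u * indicator (F 4) (u - x')"
  unfolding block_def by (auto simp: indicator_def)

lemma swap_integrals3:
  fixes f :: "complex \<Rightarrow> complex \<Rightarrow> complex \<Rightarrow> ennreal"
  assumes "(\<lambda>(x, u, v). f x u v) \<in> borel_measurable (borel \<Otimes>\<^sub>M borel \<Otimes>\<^sub>M borel)"
  shows "(\<integral>\<^sup>+x. \<integral>\<^sup>+u. \<integral>\<^sup>+v. f x u v \<partial>lborel \<partial>lborel \<partial>lborel)
       = (\<integral>\<^sup>+v. \<integral>\<^sup>+u. \<integral>\<^sup>+x. f x u v \<partial>lborel \<partial>lborel \<partial>lborel)"
proof -
  have m: "(\<lambda>x. f (a x) (b x) (c x)) \<in> borel_measurable M"
    if "a \<in> borel_measurable M" "b \<in> borel_measurable M" "c \<in> borel_measurable M"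
    for a b c and M :: "'z measure"
    using measurable_compose[OF _ assms, of "\<lambda>x. (a x, b x, c x)" M] that by simp
  note [measurable (raw)] = m
  have "(\<integral>\<^sup>+x. \<integral>\<^sup>+u. \<integral>\<^sup>+v. f x u v \<partial>lborel \<partial>lborel \<partial>lborel)
      = (\<integral>\<^sup>+u. \<integral>\<^sup>+x. \<integral>\<^sup>+v. f x u v \<partial>lborel \<partial>lborel \<partial>lborel)"
    by (rule swap_integrals) (simp add: case_prod_beta)
  also have "\<dots> = (\<integral>\<^sup>+u. \<integral>\<^sup>+v. \<integral>\<^sup>+x. f x u v \<partial>lborel \<partial>lborel \<partial>lborel)"
    by (intro nn_integral_cong swap_integrals) (simp add: case_prod_beta)
  also have "\<dots> = (\<integral>\<^sup>+v. \<integral>\<^sup>+u. \<integral>\<^sup>+x. f x u v \<partial>lborel \<partial>lborel \<partial>lborel)"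
    by (rule swap_integrals) (simp add: case_prod_beta)
  finally show ?thesis .
qed

lemma nn_integral_indicator_shift:
  fixes B :: "'a::euclidean_space set"
  assumes [measurable]: "B \<in> sets borel"
  shows "(\<integral>\<^sup>+x. indicator B (x - c) \<partial>lborel) = emeasure lborel B"
    and "(\<integral>\<^sup>+x. indicator B (c - x) \<partial>lborel) = emeasure lborel B"
  using nn_integral_lborel_translate[of "indicator B" "-c"] nn_integral_lborel_reflect[of "indicator B" c]
  by simp_all

context
  fixes F :: "nat \<Rightarrow> complex set" and e :: "nat \<Rightarrow> ennreal"
  assumes F[measurable]: "\<And>i. F i \<in> sets borel"
    and e: "\<And>i. i \<in> {1..4} \<Longrightarrow> emeasure lborel (F i) \<le> e i"
begin

private lemmas all_borel_F = allI[OF F]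
private lemmas shift = nn_integral_indicator_shift[OF F]

private lemma E: "emeasure lborel (F (Suc 0)) \<le> e (Suc 0)" "emeasure lborel (F 2) \<le> e 2"
  "emeasure lborel (F 3) \<le> e 3" "emeasure lborel (F 4) \<le> e 4"
  using e[of 1] e[of 2] e[of 3] e[of 4] by auto

text \<open>In these five pairs the edges determine \<open>x\<close> and \<open>u\<close> when \<open>x'\<close> is given. The pair of the third and the
  fourth edge does not: there both edges leave \<open>x\<close> free.\<close>

lemma pair_mass_12: "(\<integral>\<^sup>+u. \<integral>\<^sup>+x. indicator (F 1) x * indicator (F 2) (x - u) \<partial>lborel \<partial>lborel) \<le> e 1 * e 2"
  by (subst swap_integrals) (auto simp: nn_integral_cmult nn_integral_multc shift intro!: mult_mono E)

lemma pair_mass_13: "(\<integral>\<^sup>+u. \<integral>\<^sup>+x. indicator (F 1) x * indicator (F 3) u \<partial>lborel \<partial>lborel) \<le> e 1 * e 3"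
  by (auto simp: nn_integral_cmult nn_integral_multc shift intro!: mult_mono E)

lemma pair_mass_23: "(\<integral>\<^sup>+u. \<integral>\<^sup>+x. indicator (F 2) (x - u) * indicator (F 3) u \<partial>lborel \<partial>lborel) \<le> e 2 * e 3"
  by (auto simp: nn_integral_cmult nn_integral_multc shift intro!: mult_mono E)

lemma pair_mass_14: "(\<integral>\<^sup>+u. \<integral>\<^sup>+x. indicator (F 1) x * indicator (F 4) (u - x') \<partial>lborel \<partial>lborel) \<le> e 1 * e 4"
  by (auto simp: nn_integral_cmult nn_integral_multc shift intro!: mult_mono E)

lemma pair_mass_24: "(\<integral>\<^sup>+u. \<integral>\<^sup>+x. indicator (F 2) (x - u) * indicator (F 4) (u - x') \<partial>lborel \<partial>lborel) \<le> e 2 * e 4"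
  by (auto simp: nn_integral_cmult nn_integral_multc shift intro!: mult_mono E)

lemma block_mass_le:
  shows "(\<integral>\<^sup>+u. \<integral>\<^sup>+x. block F x u x' \<partial>lborel \<partial>lborel) \<le> Min {e 1 * e 2, e 1 * e 3, e 2 * e 3, e 1 * e 4, e 2 * e 4}"
proof -
  have "(\<integral>\<^sup>+u. \<integral>\<^sup>+x. block F x u x' \<partial>lborel \<partial>lborel) \<le> b"
    if "b \<in> {e 1 * e 2, e 1 * e 3, e 2 * e 3, e 1 * e 4, e 2 * e 4}" for b
    using that
    by (elim insertE emptyE; hypsubst)
      (rule order_trans[OF _ pair_mass_12] order_trans[OF _ pair_mass_13] order_trans[OF _ pair_mass_23]
        order_trans[OF _ pair_mass_14[of x']] order_trans[OF _ pair_mass_24[of x']];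
        intro nn_integral_mono block_le_pair)+
  then show ?thesis by (subst Min_ge_iff) auto
qed

context
  fixes \<gamma> :: "complex \<Rightarrow> complex \<Rightarrow> ennreal"
  assumes g: "plane_measurable \<gamma>"
begin

private lemmas measurable_rules = measurable_plane_comp[OF g] measurable_block[OF all_borel_F]

text \<open>If \<open>\<gamma>\<close> depends on the last coordinate only, then \<open>x\<close> and \<open>u\<close> are integrated first, for fixed \<open>x'\<close>, so
  that the mass of the block, bounded uniformly in \<open>x'\<close>, splits off.\<close>

lemma absorb_fst:
  assumes \<alpha>: "\<And>x t. \<gamma> x t = \<alpha> x" and s: "\<And>x'. (\<integral>\<^sup>+u. \<integral>\<^sup>+x. block F x u x' \<partial>lborel \<partial>lborel) \<le> s"
  shows "(\<integral>\<^sup>+x. absorb F \<gamma> x t \<partial>lborel) \<le> s * (\<integral>\<^sup>+x. \<alpha> x \<partial>lborel)"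
proof -
  note [measurable (raw)] = measurable_rules
  have [measurable]: "\<alpha> \<in> borel_measurable borel"
    using measurable_plane_comp[OF g, of "\<lambda>x. x" borel "\<lambda>_. 0"] by (simp add: \<alpha>)
  have "(\<integral>\<^sup>+x. absorb F \<gamma> x t \<partial>lborel) = (\<integral>\<^sup>+x'. \<integral>\<^sup>+u. \<integral>\<^sup>+x. block F x u x' * \<alpha> x' \<partial>lborel \<partial>lborel \<partial>lborel)"
    unfolding absorb_def \<alpha> by (rule swap_integrals3) (simp add: case_prod_beta)
  also have "\<dots> = (\<integral>\<^sup>+x'. (\<integral>\<^sup>+u. \<integral>\<^sup>+x. block F x u x' \<partial>lborel \<partial>lborel) * \<alpha> x' \<partial>lborel)"
    by (simp add: nn_integral_multc)
  also have "\<dots> \<le> (\<integral>\<^sup>+x'. s * \<alpha> x' \<partial>lborel)"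
    by (intro nn_integral_mono mult_right_mono s) auto
  also have "\<dots> = s * (\<integral>\<^sup>+x. \<alpha> x \<partial>lborel)" by (simp add: nn_integral_cmult)
  finally show ?thesis .
qed

text \<open>The diagonals \<open>t = z + x\<close> are the lines on which the alternating sum of a chain with one coordinate
  varies, up to the shift \<open>z\<close> caused by the blocks that have already been removed. If the kept edges
  determine \<open>x\<close> and \<open>u\<close>, then the remaining integral over \<open>x'\<close> runs along such a diagonal again.\<close>

lemma absorb_diag_spokes:
  assumes K: "\<And>z. (\<integral>\<^sup>+x. \<gamma> x (z + x) \<partial>lborel) \<le> K"
    and P[measurable]: "(\<lambda>(x, u). P x u) \<in> borel_measurable (borel \<Otimes>\<^sub>M borel)"
    and le: "\<And>x u x'. block F x u x' \<le> P x u"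
  shows "(\<integral>\<^sup>+x. absorb F \<gamma> x (z + x) \<partial>lborel) \<le> (\<integral>\<^sup>+u. \<integral>\<^sup>+x. P x u \<partial>lborel \<partial>lborel) * K"
proof -
  note [measurable (raw)] = measurable_rules
  note [measurable (raw)] = measurable_plane_comp[OF P]
  have "(\<integral>\<^sup>+x. absorb F \<gamma> x (z + x) \<partial>lborel)
      \<le> (\<integral>\<^sup>+x. \<integral>\<^sup>+u. \<integral>\<^sup>+x'. P x u * \<gamma> x' ((z + x - u) + x') \<partial>lborel \<partial>lborel \<partial>lborel)"
    unfolding absorb_def by (intro nn_integral_mono mult_right_mono le) auto
  also have "\<dots> = (\<integral>\<^sup>+x. \<integral>\<^sup>+u. P x u * (\<integral>\<^sup>+x'. \<gamma> x' ((z + x - u) + x') \<partial>lborel) \<partial>lborel \<partial>lborel)"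
    by (simp add: nn_integral_cmult)
  also have "\<dots> \<le> (\<integral>\<^sup>+x. \<integral>\<^sup>+u. P x u * K \<partial>lborel \<partial>lborel)"
    by (intro nn_integral_mono mult_left_mono K) auto
  also have "\<dots> = (\<integral>\<^sup>+u. \<integral>\<^sup>+x. P x u * K \<partial>lborel \<partial>lborel)"
    by (rule swap_integrals) (simp add: case_prod_beta)
  also have "\<dots> = (\<integral>\<^sup>+u. \<integral>\<^sup>+x. P x u \<partial>lborel \<partial>lborel) * K"
    by (simp add: nn_integral_multc)
  finally show ?thesis .
qed

text \<open>If both path edges are kept, the new variables are \<open>v = x - u\<close> and \<open>u - x'\<close>. For fixed \<open>v\<close> the
  integral over \<open>x'\<close> runs along the diagonal with shift \<open>z + v\<close>.\<close>

lemma absorb_diag_path: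
  assumes K: "\<And>z. (\<integral>\<^sup>+x. \<gamma> x (z + x) \<partial>lborel) \<le> K"
  shows "(\<integral>\<^sup>+x. absorb F \<gamma> x (z + x) \<partial>lborel) \<le> e 2 * e 4 * K"
proof -
  note [measurable (raw)] = measurable_rules
  have "(\<integral>\<^sup>+x. absorb F \<gamma> x (z + x) \<partial>lborel)
      \<le> (\<integral>\<^sup>+x. \<integral>\<^sup>+u. \<integral>\<^sup>+x'. indicator (F 2) (x - u) * indicator (F 4) (u - x')
            * \<gamma> x' (z + (x - u) + x') \<partial>lborel \<partial>lborel \<partial>lborel)"
    unfolding absorb_def by (intro nn_integral_mono mult_mono block_le_pair) (auto simp: algebra_simps)
  also have "\<dots> = (\<integral>\<^sup>+x'. \<integral>\<^sup>+u. \<integral>\<^sup>+x. indicator (F 2) (x - u) * indicator (F 4) (u - x')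
            * \<gamma> x' (z + (x - u) + x') \<partial>lborel \<partial>lborel \<partial>lborel)"
    by (rule swap_integrals3) (simp add: case_prod_beta)
  also have "\<dots> = (\<integral>\<^sup>+x'. \<integral>\<^sup>+u. \<integral>\<^sup>+x. indicator (F 2) x * indicator (F 4) (u - x')
            * \<gamma> x' (z + x + x') \<partial>lborel \<partial>lborel \<partial>lborel)"
    (is "?l = ?r")
  proof -
    have "(\<integral>\<^sup>+x. indicator (F 2) (x - u) * indicator (F 4) (u - x') * \<gamma> x' (z + (x - u) + x') \<partial>lborel)
        = (\<integral>\<^sup>+x. indicator (F 2) x * indicator (F 4) (u - x') * \<gamma> x' (z + x + x') \<partial>lborel)" for u x'
      using nn_integral_lborel_translate[of "\<lambda>x. indicator (F 2) x * indicator (F 4) (u - x')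
            * \<gamma> x' (z + x + x')" "- u"] by simp
    then show ?thesis by (simp only:)
  qed
  also have "\<dots> = (\<integral>\<^sup>+x. \<integral>\<^sup>+u. \<integral>\<^sup>+x'. indicator (F 2) x * indicator (F 4) (u - x')
            * \<gamma> x' (z + x + x') \<partial>lborel \<partial>lborel \<partial>lborel)"
    by (rule swap_integrals3[symmetric]) (simp add: case_prod_beta)
  also have "\<dots> = (\<integral>\<^sup>+x. \<integral>\<^sup>+x'. \<integral>\<^sup>+u. indicator (F 2) x * indicator (F 4) (u - x')
            * \<gamma> x' (z + x + x') \<partial>lborel \<partial>lborel \<partial>lborel)"
    by (intro nn_integral_cong swap_integrals) (simp add: case_prod_beta)
  also have "\<dots> = (\<integral>\<^sup>+x. indicator (F 2) x * (emeasure lborel (F 4) * (\<integral>\<^sup>+x'. \<gamma> x' (z + x + x') \<partial>lborel)) \<partial>lborel)"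
    by (simp add: nn_integral_cmult nn_integral_multc shift mult.assoc)
  also have "\<dots> \<le> (\<integral>\<^sup>+x. indicator (F 2) x * (e 4 * K) \<partial>lborel)"
    by (intro nn_integral_mono mult_mono K E) auto
  also have "\<dots> \<le> e 2 * e 4 * K" by (auto simp: nn_integral_multc mult.assoc intro!: mult_mono E)
  finally show ?thesis .
qed

text \<open>The pair of the third and the fourth edge determines \<open>u\<close> and \<open>x'\<close> one after the other and leaves \<open>x\<close>
  free. Integration over \<open>x\<close> then moves the alternating sum, so that the vertical integrals of \<open>\<gamma>\<close>
  replace the diagonal ones.\<close>

lemma absorb_diag_backward:
  assumes L: "\<And>x. (\<integral>\<^sup>+t. \<gamma> x t \<partial>lborel) \<le> L"
  shows "(\<integral>\<^sup>+x. absorb F \<gamma> x (z + x) \<partial>lborel) \<le> e 3 * e 4 * L"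
proof -
  note [measurable (raw)] = measurable_rules
  have "(\<integral>\<^sup>+x. absorb F \<gamma> x (z + x) \<partial>lborel)
      \<le> (\<integral>\<^sup>+x. \<integral>\<^sup>+u. \<integral>\<^sup>+x'. indicator (F 3) u * indicator (F 4) (u - x')
            * \<gamma> x' (x + (z - u + x')) \<partial>lborel \<partial>lborel \<partial>lborel)"
    unfolding absorb_def by (intro nn_integral_mono mult_mono block_le_pair) (auto simp: algebra_simps)
  also have "\<dots> = (\<integral>\<^sup>+x'. \<integral>\<^sup>+u. \<integral>\<^sup>+x. indicator (F 3) u * indicator (F 4) (u - x')
            * \<gamma> x' (x + (z - u + x')) \<partial>lborel \<partial>lborel \<partial>lborel)"
    by (rule swap_integrals3) (simp add: case_prod_beta)
  also have "\<dots> = (\<integral>\<^sup>+x'. \<integral>\<^sup>+u. indicator (F 3) u * indicator (F 4) (u - x')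
            * (\<integral>\<^sup>+t. \<gamma> x' t \<partial>lborel) \<partial>lborel \<partial>lborel)"
    by (simp add: nn_integral_cmult nn_integral_lborel_translate)
  also have "\<dots> \<le> (\<integral>\<^sup>+x'. \<integral>\<^sup>+u. indicator (F 3) u * indicator (F 4) (u - x') * L \<partial>lborel \<partial>lborel)"
    by (intro nn_integral_mono mult_left_mono L) auto
  also have "\<dots> = (\<integral>\<^sup>+u. \<integral>\<^sup>+x'. indicator (F 3) u * indicator (F 4) (u - x') * L \<partial>lborel \<partial>lborel)"
    by (rule swap_integrals) (simp add: case_prod_beta)
  also have "\<dots> \<le> e 3 * e 4 * L"
    by (auto simp: nn_integral_cmult nn_integral_multc shift mult.assoc intro!: mult_mono E)
  finally show ?thesis .
qed

text \<open>After the step of the previous lemma the alternating sum is used up, and the remaining blocks are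
  integrated in the opposite direction: \<open>u\<close> and \<open>x'\<close> for fixed \<open>x\<close>. Of the edges \<open>x - u\<close> and \<open>u\<close> one may
  choose either; the fourth edge is always needed to reach \<open>x'\<close>.\<close>

lemma absorb_vertical:
  assumes L: "\<And>x. (\<integral>\<^sup>+t. \<gamma> x t \<partial>lborel) \<le> L"
  shows "(\<integral>\<^sup>+t. absorb F \<gamma> x t \<partial>lborel) \<le> min (e 2 * e 4) (e 3 * e 4) * L"
proof -
  note [measurable (raw)] = measurable_rules
  have "(\<integral>\<^sup>+t. absorb F \<gamma> x t \<partial>lborel)
      = (\<integral>\<^sup>+x'. \<integral>\<^sup>+u. \<integral>\<^sup>+t. block F x u x' * \<gamma> x' (t + (x' - u)) \<partial>lborel \<partial>lborel \<partial>lborel)"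
    unfolding absorb_def by (subst swap_integrals3) (simp_all add: case_prod_beta algebra_simps)
  also have "\<dots> = (\<integral>\<^sup>+x'. \<integral>\<^sup>+u. block F x u x' * (\<integral>\<^sup>+t. \<gamma> x' t \<partial>lborel) \<partial>lborel \<partial>lborel)"
    by (simp add: nn_integral_cmult nn_integral_lborel_translate)
  also have "\<dots> \<le> (\<integral>\<^sup>+x'. \<integral>\<^sup>+u. block F x u x' * L \<partial>lborel \<partial>lborel)"
    by (intro nn_integral_mono mult_left_mono L) auto
  also have "\<dots> = (\<integral>\<^sup>+u. \<integral>\<^sup>+x'. block F x u x' * L \<partial>lborel \<partial>lborel)"
    by (rule swap_integrals) (simp add: case_prod_beta)
  also have "\<dots> = (\<integral>\<^sup>+u. \<integral>\<^sup>+x'. block F x u x' \<partial>lborel \<partial>lborel) * L"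
    by (simp add: nn_integral_multc)
  also have "\<dots> \<le> min (e 2 * e 4) (e 3 * e 4) * L"
  proof (intro mult_right_mono min.boundedI)
    have "(\<integral>\<^sup>+u. \<integral>\<^sup>+x'. block F x u x' \<partial>lborel \<partial>lborel)
        \<le> (\<integral>\<^sup>+u. \<integral>\<^sup>+x'. indicator (F 2) (x - u) * indicator (F 4) (u - x') \<partial>lborel \<partial>lborel)"
      by (intro nn_integral_mono block_le_pair)
    also have "\<dots> \<le> e 2 * e 4"
      by (auto simp: nn_integral_cmult nn_integral_multc shift intro!: mult_mono E)
    finally show "(\<integral>\<^sup>+u. \<integral>\<^sup>+x'. block F x u x' \<partial>lborel \<partial>lborel) \<le> e 2 * e 4" .
    have "(\<integral>\<^sup>+u. \<integral>\<^sup>+x'. block F x u x' \<partial>lborel \<partial>lborel)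
        \<le> (\<integral>\<^sup>+u. \<integral>\<^sup>+x'. indicator (F 3) u * indicator (F 4) (u - x') \<partial>lborel \<partial>lborel)"
      by (intro nn_integral_mono block_le_pair)
    also have "\<dots> \<le> e 3 * e 4"
      by (auto simp: nn_integral_cmult nn_integral_multc shift intro!: mult_mono E)
    finally show "(\<integral>\<^sup>+u. \<integral>\<^sup>+x'. block F x u x' \<partial>lborel \<partial>lborel) \<le> e 3 * e 4" .
  qed auto
  finally show ?thesis .
qed

lemma absorb_diag_forward:
  assumes K: "\<And>z. (\<integral>\<^sup>+x. \<gamma> x (z + x) \<partial>lborel) \<le> K"
  shows "(\<integral>\<^sup>+x. absorb F \<gamma> x (z + x) \<partial>lborel) \<le> Min {e 1 * e 2, e 1 * e 3, e 2 * e 3, e 2 * e 4} * K"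
proof -
  note [measurable (raw)] = measurable_rules
  have *: "Min {e 1 * e 2, e 1 * e 3, e 2 * e 3, e 2 * e 4} \<in> {e 1 * e 2, e 1 * e 3, e 2 * e 3, e 2 * e 4}"
    by (rule Min_in) auto
  have 12: "(\<integral>\<^sup>+x. absorb F \<gamma> x (z + x) \<partial>lborel) \<le> e 1 * e 2 * K"
    by (rule order_trans[OF absorb_diag_spokes[OF K _ block_le_pair(1)] mult_right_mono[OF pair_mass_12]])
      (auto simp: case_prod_beta)
  have 13: "(\<integral>\<^sup>+x. absorb F \<gamma> x (z + x) \<partial>lborel) \<le> e 1 * e 3 * K"
    by (rule order_trans[OF absorb_diag_spokes[OF K _ block_le_pair(2)] mult_right_mono[OF pair_mass_13]])
      (auto simp: case_prod_beta)
  have 23: "(\<integral>\<^sup>+x. absorb F \<gamma> x (z + x) \<partial>lborel) \<le> e 2 * e 3 * K"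
    by (rule order_trans[OF absorb_diag_spokes[OF K _ block_le_pair(3)] mult_right_mono[OF pair_mass_23]])
      (auto simp: case_prod_beta)
  show ?thesis
    using * 12 13 23 absorb_diag_path[OF K] by (elim insertE emptyE) (simp_all only:)
qed

end

end

section \<open>Bounds for chains of indicator functions\<close>

lemma plane_measurable_fst: "\<alpha> \<in> borel_measurable borel \<Longrightarrow> plane_measurable (\<lambda>x t. \<alpha> x)"
  and plane_measurable_snd: "\<alpha> \<in> borel_measurable borel \<Longrightarrow> plane_measurable (\<lambda>x t. \<alpha> t)"
  unfolding case_prod_beta
  by (erule measurable_compose[OF measurable_fst] measurable_compose[OF measurable_snd])+

lemma chain_form_0:
  assumes g: "plane_measurable \<gamma>"
  shows "chain_form 0 F \<gamma> = (\<integral>\<^sup>+x. \<gamma> x x \<partial>lborel)"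
proof -
  interpret product_sigma_finite "\<lambda>_::nat. lborel :: complex measure" ..
  have "(\<lambda>x. \<gamma> x x) \<in> borel_measurable lborel"
    by (rule measurable_plane_comp[OF g]) simp_all
  then have "(\<integral>\<^sup>+x. \<gamma> (x 1) (x 1) \<partial>Pi\<^sub>M {1::nat} (\<lambda>_. lborel)) = (\<integral>\<^sup>+x. \<gamma> x x \<partial>lborel)"
    by (rule product_nn_integral_singleton[where f = "\<lambda>x. \<gamma> x x" and i = 1])
  moreover have "{1..2 * 0 + 1} = {1::nat}" "2 * 0 + 1 = (1::nat)" "alt_sum 1 x = x 1" for x
    by (auto simp: alt_sum_def)
  ultimately show ?thesis
    unfolding chain_form_def by (simp only: lessThan_0 prod.empty mult_1)
qed

text \<open>The price of one block in the three families of choices: spoke (the last spoke completes the basis),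
  forward (the alternating sum completes it, and the block determines \<open>x\<close> and \<open>u\<close> or the differences \<open>x - u\<close>
  and \<open>u - x'\<close>), and backward (the alternating sum completes it, and the block determines \<open>u\<close> and \<open>x'\<close> or
  the two differences).\<close>

definition spoke_cost :: "(nat \<Rightarrow> ennreal) \<Rightarrow> ennreal" where
  "spoke_cost e = Min {e 1 * e 2, e 1 * e 3, e 2 * e 3, e 1 * e 4, e 2 * e 4}"

definition forward_cost :: "(nat \<Rightarrow> ennreal) \<Rightarrow> ennreal" where
  "forward_cost e = Min {e 1 * e 2, e 1 * e 3, e 2 * e 3, e 2 * e 4}"

definition backward_cost :: "(nat \<Rightarrow> ennreal) \<Rightarrow> ennreal" where
  "backward_cost e = min (e 2 * e 4) (e 3 * e 4)"

context
  fixes F :: "nat \<Rightarrow> nat \<Rightarrow> complex set" and e :: "nat \<Rightarrow> nat \<Rightarrow> ennreal"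
  assumes F: "\<And>k i. F k i \<in> sets borel"
    and e: "\<And>k i. i \<in> {1..4} \<Longrightarrow> emeasure lborel (F k i) \<le> e k i"
begin

private lemma borel_block_F: "borel_block (F k)" by (intro allI F)

lemma chain_form_fst_le:
  assumes "\<alpha> \<in> borel_measurable borel"
  shows "chain_form m F (\<lambda>x t. \<alpha> x) \<le> (\<Prod>k<m. spoke_cost (e k)) * (\<integral>\<^sup>+x. \<alpha> x \<partial>lborel)"
  using assms
proof (induction m arbitrary: \<alpha>)
  case 0
  show ?case
    by (simp only: chain_form_0[OF plane_measurable_fst[OF 0]] lessThan_0 prod.empty mult_1 order_refl)
next
  case (Suc m)
  let ?\<alpha> = "\<lambda>x. absorb (F m) (\<lambda>x t. \<alpha> x) x 0"
  have g: "plane_measurable (\<lambda>x t. \<alpha> x)" by (rule plane_measurable_fst[OF Suc.prems])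
  have eq: "absorb (F m) (\<lambda>x t. \<alpha> x) = (\<lambda>x t. ?\<alpha> x)"
    by (intro ext) (simp only: absorb_def)
  have "chain_form (Suc m) F (\<lambda>x t. \<alpha> x) = chain_form m F (\<lambda>x t. ?\<alpha> x)"
    unfolding chain_form_Suc[OF g borel_block_F] by (rule arg_cong[where f = "chain_form m F", OF eq])
  also have "\<dots> \<le> (\<Prod>k<m. spoke_cost (e k)) * (\<integral>\<^sup>+x. ?\<alpha> x \<partial>lborel)"
  proof (rule Suc.IH)
    show "?\<alpha> \<in> borel_measurable borel"
      by (rule measurable_plane_comp[OF measurable_absorb[OF g borel_block_F]]) simp_all
  qed
  also have "\<dots> \<le> (\<Prod>k<m. spoke_cost (e k)) * (spoke_cost (e m) * (\<integral>\<^sup>+x. \<alpha> x \<partial>lborel))"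
    unfolding spoke_cost_def[of "e m"]
    by (intro mult_left_mono absorb_fst block_mass_le F e g) auto
  finally show ?case by (simp add: mult.assoc)
qed

lemma chain_form_forward_le:
  assumes "plane_measurable \<gamma>" "\<And>z. (\<integral>\<^sup>+x. \<gamma> x (z + x) \<partial>lborel) \<le> K"
  shows "chain_form m F \<gamma> \<le> (\<Prod>k<m. forward_cost (e k)) * K"
  using assms
proof (induction m arbitrary: \<gamma> K)
  case 0
  show ?case
    using 0(2)[of 0] by (simp only: chain_form_0[OF 0(1)] lessThan_0 prod.empty mult_1 add_0)
next
  case (Suc m)
  have "chain_form (Suc m) F \<gamma> = chain_form m F (absorb (F m) \<gamma>)"
    by (rule chain_form_Suc[OF Suc.prems(1) borel_block_F])
  also have "\<dots> \<le> (\<Prod>k<m. forward_cost (e k)) * (forward_cost (e m) * K)"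
    unfolding forward_cost_def[of "e m"]
    by (intro Suc.IH measurable_absorb absorb_diag_forward Suc.prems F borel_block_F e)
  finally show ?case by (simp add: mult.assoc)
qed

text \<open>Both kinds of integrals have to be carried through the induction: keeping both path edges stays on the
  diagonals, and the other pair passes from the diagonals to the vertical lines, from which there is no way
  back.\<close>

lemma chain_form_backward_le:
  assumes "plane_measurable \<gamma>" "\<And>z. (\<integral>\<^sup>+x. \<gamma> x (z + x) \<partial>lborel) \<le> K"
    "\<And>x. (\<integral>\<^sup>+t. \<gamma> x t \<partial>lborel) \<le> K"
  shows "chain_form m F \<gamma> \<le> (\<Prod>k<m. backward_cost (e k)) * K"
  using assms
proof (induction m arbitrary: \<gamma> K)
  case 0
  show ?case
    using 0(2)[of 0] by (simp only: chain_form_0[OF 0(1)] lessThan_0 prod.empty mult_1 add_0)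
next
  case (Suc m)
  have diag: "(\<integral>\<^sup>+x. absorb (F m) \<gamma> x (z + x) \<partial>lborel) \<le> backward_cost (e m) * K" for z
    using absorb_diag_path[of "F m" "e m" \<gamma>, OF F e Suc.prems(1) Suc.prems(2), of z]
      absorb_diag_backward[of "F m" "e m" \<gamma>, OF F e Suc.prems(1) Suc.prems(3), of z]
    by (auto simp: backward_cost_def min_def)
  have "chain_form (Suc m) F \<gamma> = chain_form m F (absorb (F m) \<gamma>)"
    by (rule chain_form_Suc[OF Suc.prems(1) borel_block_F])
  also have "\<dots> \<le> (\<Prod>k<m. backward_cost (e k)) * (backward_cost (e m) * K)"
  proof (rule Suc.IH)
    show "(\<integral>\<^sup>+t. absorb (F m) \<gamma> x t \<partial>lborel) \<le> backward_cost (e m) * K" for x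
      unfolding backward_cost_def by (intro absorb_vertical Suc.prems F e)
  qed (intro measurable_absorb diag Suc.prems borel_block_F)+
  finally show ?case by (simp add: mult.assoc)
qed

end

section \<open>Hoelder's inequality with a weight\<close>

text \<open>Proved from Young's inequality for the functions normalised by \<open>a\<close> and \<open>b\<close>, which are only upper bounds
  for the integrals. For the chains, \<open>P\<close> is the product of all indicators; it enters both integrals
  unchanged.\<close>

lemma nn_integral_Hoelder_bound:
  fixes f g :: "'a \<Rightarrow> real" and P :: "'a \<Rightarrow> ennreal"
  assumes [measurable]: "f \<in> borel_measurable M" "g \<in> borel_measurable M" "P \<in> borel_measurable M"
    and nonneg: "\<And>x. 0 \<le> f x" "\<And>x. 0 \<le> g x"
    and w: "0 < v" "0 < w" "v + w = 1"
    and f: "(\<integral>\<^sup>+x. P x * ennreal (f x powr (1 / v)) \<partial>M) \<le> ennreal a" "0 \<le> a"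
    and g: "(\<integral>\<^sup>+x. P x * ennreal (g x powr (1 / w)) \<partial>M) \<le> ennreal b" "0 \<le> b"
  shows "(\<integral>\<^sup>+x. P x * (ennreal (f x) * ennreal (g x)) \<partial>M) \<le> ennreal (a powr v * b powr w)"
proof (cases "a = 0 \<or> b = 0")
  case True
  have "AE x in M. P x * ennreal (f x powr (1 / v)) = 0 \<or> P x * ennreal (g x powr (1 / w)) = 0"
  proof -
    from True show ?thesis
    proof
      assume "a = 0"
      then have "(\<integral>\<^sup>+x. P x * ennreal (f x powr (1 / v)) \<partial>M) = 0" using f by simp
      then show ?thesis by (subst (asm) nn_integral_0_iff_AE) auto
    next
      assume "b = 0"
      then have "(\<integral>\<^sup>+x. P x * ennreal (g x powr (1 / w)) \<partial>M) = 0" using g by simp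
      then show ?thesis by (subst (asm) nn_integral_0_iff_AE) auto
    qed
  qed
  then have "AE x in M. P x * (ennreal (f x) * ennreal (g x)) = 0"
    by (rule AE_mp) (auto simp: ennreal_eq_0_iff)
  then have "(\<integral>\<^sup>+x. P x * (ennreal (f x) * ennreal (g x)) \<partial>M) = 0"
    by (subst nn_integral_0_iff_AE) auto
  then show ?thesis by simp
next
  case False
  with f g have a: "0 < a" "0 < b" by auto
  \<comment> \<open>Young's inequality for \<open>f powr (1 / v) / a\<close> and \<open>g powr (1 / w) / b\<close>, multiplied by \<open>?c\<close>\<close>
  let ?c = "a powr v * b powr w"
  have le: "f x * g x \<le> (?c * v / a) * f x powr (1 / v) + (?c * w / b) * g x powr (1 / w)" for x
  proof (cases "f x = 0 \<or> g x = 0")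
    case True
    then show ?thesis using a w by auto
  next
    case False
    then have pos: "0 < f x" "0 < g x" using nonneg[of x] by (auto simp: less_le)
    have "(f x powr (1 / v) / a) powr v * (g x powr (1 / w) / b) powr w
        \<le> v * (f x powr (1 / v) / a) + w * (g x powr (1 / w) / b)"
      using pos a w by (intro Youngs_inequality_0) auto
    moreover have "(f x powr (1 / v) / a) powr v * (g x powr (1 / w) / b) powr w = f x * g x / ?c"
      using pos a w by (simp add: powr_divide powr_powr)
    ultimately have "f x * g x / ?c \<le> v * (f x powr (1 / v) / a) + w * (g x powr (1 / w) / b)" by simp
    then have "?c * (f x * g x / ?c) \<le> ?c * (v * (f x powr (1 / v) / a) + w * (g x powr (1 / w) / b))"
      using a by (intro mult_left_mono) auto
    then show ?thesis using a by (simp add: algebra_simps)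
  qed
  have "(\<integral>\<^sup>+x. P x * (ennreal (f x) * ennreal (g x)) \<partial>M)
      \<le> (\<integral>\<^sup>+x. ennreal (?c * v / a) * (P x * ennreal (f x powr (1 / v)))
            + ennreal (?c * w / b) * (P x * ennreal (g x powr (1 / w))) \<partial>M)"
  proof (rule nn_integral_mono)
    fix x
    have "ennreal (f x) * ennreal (g x)
        \<le> ennreal ((?c * v / a) * f x powr (1 / v) + (?c * w / b) * g x powr (1 / w))"
      using nonneg[of x] le[of x] by (simp add: ennreal_leI flip: ennreal_mult)
    also have "\<dots> = ennreal (?c * v / a) * ennreal (f x powr (1 / v)) + ennreal (?c * w / b) * ennreal (g x powr (1 / w))"
      using a w by (simp add: ennreal_plus ennreal_mult[symmetric] del: times_divide_eq_left)
    finally have "P x * (ennreal (f x) * ennreal (g x)) \<le> P x *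
      (ennreal (?c * v / a) * ennreal (f x powr (1 / v)) + ennreal (?c * w / b) * ennreal (g x powr (1 / w)))"
      by (rule mult_left_mono) simp
    then show "P x * (ennreal (f x) * ennreal (g x))
        \<le> ennreal (?c * v / a) * (P x * ennreal (f x powr (1 / v)))
            + ennreal (?c * w / b) * (P x * ennreal (g x powr (1 / w)))"
      by (simp add: distrib_left mult.left_commute)
  qed
  also have "\<dots> = ennreal (?c * v / a) * (\<integral>\<^sup>+x. P x * ennreal (f x powr (1 / v)) \<partial>M)
      + ennreal (?c * w / b) * (\<integral>\<^sup>+x. P x * ennreal (g x powr (1 / w)) \<partial>M)"
    by (simp add: nn_integral_add nn_integral_cmult)
  also have "\<dots> \<le> ennreal (?c * v / a) * ennreal a + ennreal (?c * w / b) * ennreal b"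
    by (intro add_mono mult_left_mono f g) auto
  also have "\<dots> = ennreal (?c * v + ?c * w)"
    using a w by (simp flip: ennreal_mult ennreal_plus)
  also have "?c * v + ?c * w = ?c" using w by (simp flip: distrib_left)
  finally show ?thesis .
qed

section \<open>The inequality between the exponents\<close>

text \<open>With total weight \<open>2\<close>, moving weight from the high numbers \<open>c, d\<close> to the low numbers \<open>a, b\<close> makes the sum
  smaller, and the bounds on the weights limit how much can be moved. The number \<open>p\<close> in the proof separates
  the low numbers from the high ones.\<close>

lemma weighted_sum_ge_of_low_pair:
  fixes a b c d ta tb tc td \<epsilon> :: real
  assumes low: "a \<le> c" "a \<le> d" "b \<le> c" "b \<le> d"
    and sum: "ta + tb + tc + td = 2"
    and t: "ta \<le> 3/5 - \<epsilon>" "tb \<le> 3/5 - \<epsilon>" "2/5 + \<epsilon> \<le> tc" "2/5 + \<epsilon> \<le> td"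
  shows "3/5 * (a + b) + 2/5 * (c + d) + \<epsilon> * (c + d - a - b) \<le> ta * a + tb * b + tc * c + td * d"
proof -
  define p where "p = max a b"
  have "(3/5 - \<epsilon>) * (a - p) \<le> ta * (a - p)" "(3/5 - \<epsilon>) * (b - p) \<le> tb * (b - p)"
    using t by (intro mult_right_mono_neg; simp add: p_def)+
  moreover have "(2/5 + \<epsilon>) * (c - p) \<le> tc * (c - p)" "(2/5 + \<epsilon>) * (d - p) \<le> td * (d - p)"
    using t low by (intro mult_right_mono; simp add: p_def)+
  moreover have "ta * (a - p) + tb * (b - p) + tc * (c - p) + td * (d - p)
      = ta * a + tb * b + tc * c + td * d - p * (ta + tb + tc + td)"
    by (simp add: algebra_simps)
  moreover have "(3/5 - \<epsilon>) * (a - p) + (3/5 - \<epsilon>) * (b - p) + (2/5 + \<epsilon>) * (c - p) + (2/5 + \<epsilon>) * (d - p)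
      = 3/5 * (a + b) + 2/5 * (c + d) + \<epsilon> * (c + d - a - b) - p * 2"
    by (simp add: field_simps)
  ultimately show ?thesis unfolding sum by linarith
qed

lemma affine_le_of_endpoints:
  fixes a b :: real
  assumes "X + a * D \<le> R" "X + b * D \<le> R" "a \<le> w" "w \<le> b"
  shows "X + w * D \<le> R"
proof (cases "0 \<le> D")
  case True
  then have "w * D \<le> b * D" using assms by (intro mult_right_mono)
  then show ?thesis using assms by linarith
next
  case False
  then have "w * D \<le> a * D" using assms by (intro mult_right_mono_neg) auto
  then show ?thesis using assms by linarith
qed

text \<open>By \<open>weighted_sum_ge_of_low_pair\<close> the sum on the right is at least \<open>3/5 (a + b) + 2/5 (c + d)\<close>, where
  \<open>a, b\<close> are the two low numbers, and the gain in that lemma pays for the term with \<open>\<epsilon>\<close>. The left side is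
  affine in \<open>w\<close>, so the end points \<open>2/5\<close> and \<open>3/5\<close> suffice. A share of at least \<open>1/5\<close> for \<open>B\<close> is necessary: if
  \<open>n3 = n4 = -1\<close> and \<open>n1 = n2 = 0\<close>, then \<open>S = Fw = -1\<close> and \<open>B = -2\<close> are allowed, while the right side can be \<open>-6/5\<close> for
  \<open>\<epsilon> = 0\<close>.\<close>

lemma exponent_gain:
  fixes n1 n2 n3 n4 t1 t2 t3 t4 \<epsilon> w S Fw B :: real
  assumes t: "t1 + t2 + t3 + t4 = 2" "0 \<le> \<epsilon>"
      "\<bar>t1 - 1/2\<bar> + \<epsilon> \<le> 1/10" "\<bar>t2 - 1/2\<bar> + \<epsilon> \<le> 1/10" "\<bar>t3 - 1/2\<bar> + \<epsilon> \<le> 1/10" "\<bar>t4 - 1/2\<bar> + \<epsilon> \<le> 1/10"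
    and w: "2/5 \<le> w" "w \<le> 3/5"
    and S: "S \<le> n1 + n2" "S \<le> n1 + n3" "S \<le> n2 + n3" "S \<le> n1 + n4" "S \<le> n2 + n4"
    and Fw: "Fw \<le> n1 + n2" "Fw \<le> n1 + n3" "Fw \<le> n2 + n3" "Fw \<le> n2 + n4"
    and B: "B \<le> n2 + n4" "B \<le> n3 + n4"
  shows "w * S + (4/5 - w) * Fw + 1/5 * B
    \<le> t1 * n1 + t2 * n2 + t3 * n3 + t4 * n4 - \<epsilon> * ((\<bar>n2 - n1\<bar> + \<bar>n3 - n1\<bar> + \<bar>n4 - n1\<bar>) / 3)"
proof -
  have bounds: "t1 \<le> 3/5 - \<epsilon>" "t2 \<le> 3/5 - \<epsilon>" "t3 \<le> 3/5 - \<epsilon>" "t4 \<le> 3/5 - \<epsilon>"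
    "2/5 + \<epsilon> \<le> t1" "2/5 + \<epsilon> \<le> t2" "2/5 + \<epsilon> \<le> t3" "2/5 + \<epsilon> \<le> t4"
    using t(3-6) by linarith+
  have core: ?thesis
    if R: "3/5 * (a + b) + 2/5 * (c + d) + \<epsilon> * (c + d - a - b) \<le> t1 * n1 + t2 * n2 + t3 * n3 + t4 * n4"
      and spread: "n2 - n1 \<le> c + d - a - b" "n1 - n2 \<le> c + d - a - b" "n3 - n1 \<le> c + d - a - b"
        "n1 - n3 \<le> c + d - a - b" "n4 - n1 \<le> c + d - a - b" "n1 - n4 \<le> c + d - a - b"
      and ends: "2 * S + 2 * Fw + B \<le> 3 * (a + b) + 2 * (c + d)"
        "3 * S + Fw + B \<le> 3 * (a + b) + 2 * (c + d)"
    for a b c d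
  proof -
    have "4/5 * Fw + 1/5 * B + w * (S - Fw) \<le> 3/5 * (a + b) + 2/5 * (c + d)"
      by (rule affine_le_of_endpoints[OF _ _ w]) (use ends in \<open>simp_all add: field_simps\<close>)
    moreover have "\<epsilon> * ((\<bar>n2 - n1\<bar> + \<bar>n3 - n1\<bar> + \<bar>n4 - n1\<bar>) / 3) \<le> \<epsilon> * (c + d - a - b)"
      using spread t(2) by (intro mult_left_mono) (auto simp: abs_if)
    ultimately show ?thesis using R by (simp add: algebra_simps)
  qed
  have sums: "t1 + t2 + t3 + t4 = 2" "t1 + t3 + t2 + t4 = 2" "t1 + t4 + t2 + t3 = 2"
    "t2 + t3 + t1 + t4 = 2" "t2 + t4 + t1 + t3 = 2" "t3 + t4 + t1 + t2 = 2"
    using t(1) by linarith+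
  \<comment> \<open>Which pair is the low one? After that no further sorting is needed.\<close>
  consider "n1 \<le> n3" "n1 \<le> n4" "n2 \<le> n3" "n2 \<le> n4"
    | "n1 \<le> n2" "n1 \<le> n4" "n3 \<le> n2" "n3 \<le> n4"
    | "n1 \<le> n2" "n1 \<le> n3" "n4 \<le> n2" "n4 \<le> n3"
    | "n2 \<le> n1" "n2 \<le> n4" "n3 \<le> n1" "n3 \<le> n4"
    | "n2 \<le> n1" "n2 \<le> n3" "n4 \<le> n1" "n4 \<le> n3"
    | "n3 \<le> n1" "n3 \<le> n2" "n4 \<le> n1" "n4 \<le> n2"
    by (smt (verit))
  then show ?thesis
  proof cases
    case 1
    note low = weighted_sum_ge_of_low_pair[OF 1 sums(1) bounds(1) bounds(2) bounds(7) bounds(8)]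
    show ?thesis
      by (rule core[where a=n1 and c=n3 and d=n4 and b=n2]; (use low in linarith | use 1 S Fw B in argo))
  next
    case 2
    note low = weighted_sum_ge_of_low_pair[OF 2 sums(2) bounds(1) bounds(3) bounds(6) bounds(8)]
    show ?thesis
      by (rule core[where a=n1 and c=n2 and d=n4 and b=n3]; (use low in linarith | use 2 S Fw B in argo))
  next
    case 3
    note low = weighted_sum_ge_of_low_pair[OF 3 sums(3) bounds(1) bounds(4) bounds(6) bounds(7)]
    show ?thesis
      by (rule core[where a=n1 and c=n2 and d=n3 and b=n4]; (use low in linarith | use 3 S Fw B in argo))
  next
    case 4
    note low = weighted_sum_ge_of_low_pair[OF 4 sums(4) bounds(2) bounds(3) bounds(5) bounds(8)]
    show ?thesis
      by (rule core[where a=n2 and c=n1 and d=n4 and b=n3]; (use low in linarith | use 4 S Fw B in argo))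
  next
    case 5
    note low = weighted_sum_ge_of_low_pair[OF 5 sums(5) bounds(2) bounds(4) bounds(5) bounds(7)]
    show ?thesis
      by (rule core[where a=n2 and c=n1 and d=n3 and b=n4]; (use low in linarith | use 5 S Fw B in argo))
  next
    case 6
    note low = weighted_sum_ge_of_low_pair[OF 6 sums(6) bounds(3) bounds(4) bounds(5) bounds(6)]
    show ?thesis
      by (rule core[where a=n3 and c=n1 and d=n2 and b=n4]; (use low in linarith | use 6 S Fw B in argo))
  qed
qed

section \<open>Chains of sets of given size\<close>

text \<open>Comparable with the diameter of \<open>{n 1, n 2, n 3, n 4}\<close>, and chosen in this form because
  \<open>exp (- \<epsilon> * spread n)\<close> is a product of functions of the three differences.\<close>

definition spread :: "(nat \<Rightarrow> real) \<Rightarrow> real" where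
  "spread n = (\<bar>n 2 - n 1\<bar> + \<bar>n 3 - n 1\<bar> + \<bar>n 4 - n 1\<bar>) / 3"

text \<open>Logarithms of the three prices for sets of measure \<open>exp (n i)\<close>.\<close>

definition spoke_exp :: "(nat \<Rightarrow> real) \<Rightarrow> real" where
  "spoke_exp n = Min {n 1 + n 2, n 1 + n 3, n 2 + n 3, n 1 + n 4, n 2 + n 4}"

definition forward_exp :: "(nat \<Rightarrow> real) \<Rightarrow> real" where
  "forward_exp n = Min {n 1 + n 2, n 1 + n 3, n 2 + n 3, n 2 + n 4}"

definition backward_exp :: "(nat \<Rightarrow> real) \<Rightarrow> real" where
  "backward_exp n = min (n 2 + n 4) (n 3 + n 4)"

lemma costs_of_exp:
  fixes n :: "nat \<Rightarrow> real"
  defines "e \<equiv> \<lambda>i. ennreal (exp (n i))"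
  shows "spoke_cost e \<le> ennreal (exp (spoke_exp n))"
    and "forward_cost e \<le> ennreal (exp (forward_exp n))"
    and "backward_cost e \<le> ennreal (exp (backward_exp n))"
proof -
  have e: "e i * e j = ennreal (exp (n i + n j))" for i j
    by (simp add: e_def exp_add ennreal_mult)
  have "spoke_exp n \<in> {n 1 + n 2, n 1 + n 3, n 2 + n 3, n 1 + n 4, n 2 + n 4}"
    unfolding spoke_exp_def by (rule Min_in) auto
  then show "spoke_cost e \<le> ennreal (exp (spoke_exp n))"
    unfolding spoke_cost_def e by (intro Min_le) auto
  have "forward_exp n \<in> {n 1 + n 2, n 1 + n 3, n 2 + n 3, n 2 + n 4}"
    unfolding forward_exp_def by (rule Min_in) auto
  then show "forward_cost e \<le> ennreal (exp (forward_exp n))"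
    unfolding forward_cost_def e by (intro Min_le) auto
  show "backward_cost e \<le> ennreal (exp (backward_exp n))"
    unfolding backward_cost_def backward_exp_def e by (auto simp: min_def)
qed

text \<open>The restricted estimate. Hoelder's inequality splits the chain into one with \<open>\<alpha>\<close> alone and one with \<open>\<beta>\<close>
  alone; for the second there are two bounds, and their minimum is interpolated once more.\<close>

lemma chain_form_elementary_le:
  fixes E :: "nat \<Rightarrow> nat \<Rightarrow> complex set" and n \<tau> :: "nat \<Rightarrow> nat \<Rightarrow> real" and \<alpha> \<beta> :: "complex \<Rightarrow> real"
  assumes E: "\<And>k i. E k i \<in> sets borel"
    and size: "\<And>k i. i \<in> {1..4} \<Longrightarrow> emeasure lborel (E k i) \<le> ennreal (exp (n k i))"
    and \<alpha>[measurable]: "\<alpha> \<in> borel_measurable borel" and \<beta>[measurable]: "\<beta> \<in> borel_measurable borel"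
    and nonneg: "\<And>x. 0 \<le> \<alpha> x" "\<And>x. 0 \<le> \<beta> x"
    and vw: "2/5 \<le> v" "v \<le> 3/5" "v + w = 1"
    and A: "(\<integral>\<^sup>+x. ennreal (\<alpha> x powr (1 / v)) \<partial>lborel) = ennreal A" "0 \<le> A"
    and B: "(\<integral>\<^sup>+x. ennreal (\<beta> x powr (1 / w)) \<partial>lborel) = ennreal B" "0 \<le> B"
    and \<tau>: "\<And>k. k < m \<Longrightarrow> \<tau> k 1 + \<tau> k 2 + \<tau> k 3 + \<tau> k 4 = 2"
      "\<And>k i. k < m \<Longrightarrow> i \<in> {1..4} \<Longrightarrow> \<bar>\<tau> k i - 1/2\<bar> + \<epsilon> \<le> 1/10" "0 \<le> \<epsilon>"
  shows "chain_form m E (\<lambda>x t. ennreal (\<alpha> x) * ennreal (\<beta> t))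
     \<le> ennreal (A powr v * B powr w)
       * (\<Prod>k<m. ennreal (exp ((\<Sum>i=1..4. \<tau> k i * n k i) - \<epsilon> * spread (n k))))"
proof -
  let ?e = "\<lambda>k i. ennreal (exp (n k i))"
  define S F G where "S k = spoke_exp (n k)" "F k = forward_exp (n k)" "G k = backward_exp (n k)" for k
  have costs: "spoke_cost (?e k) \<le> ennreal (exp (S k))" "forward_cost (?e k) \<le> ennreal (exp (F k))"
    "backward_cost (?e k) \<le> ennreal (exp (G k))" for k
    unfolding S_F_G_def by (rule costs_of_exp)+
  have gain: "v * S k + (4/5 - v) * F k + 1/5 * G k \<le> (\<Sum>i=1..4. \<tau> k i * n k i) - \<epsilon> * spread (n k)"
    if "k < m" for k
  proof -
    have sum4: "(\<Sum>i=1..4. f i) = f 1 + f 2 + f 3 + f 4" for f :: "nat \<Rightarrow> real"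
      by (simp add: eval_nat_numeral)
    show ?thesis
      unfolding sum4 spread_def
    proof (rule exponent_gain[OF \<tau>(1)[OF that] \<tau>(3) _ _ _ _ vw(1,2)])
      show "S k \<le> n k 1 + n k 2" "S k \<le> n k 1 + n k 3" "S k \<le> n k 2 + n k 3" "S k \<le> n k 1 + n k 4" "S k \<le> n k 2 + n k 4"
        unfolding S_F_G_def spoke_exp_def by (rule Min_le; simp)+
      show "F k \<le> n k 1 + n k 2" "F k \<le> n k 1 + n k 3" "F k \<le> n k 2 + n k 3" "F k \<le> n k 2 + n k 4"
        unfolding S_F_G_def forward_exp_def by (rule Min_le; simp)+
      show "G k \<le> n k 2 + n k 4" "G k \<le> n k 3 + n k 4"
        unfolding S_F_G_def backward_exp_def by simp_all
    qed (rule \<tau>(2)[OF that]; simp)+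
  qed
  have prod_le: "(\<Prod>k<m. c k) * ennreal C \<le> ennreal (exp (\<Sum>k<m. X k) * C)"
    if "\<And>k. c k \<le> ennreal (exp (X k))" "0 \<le> C" for c and X :: "nat \<Rightarrow> real" and C :: real
  proof -
    have "(\<Prod>k<m. c k) \<le> (\<Prod>k<m. ennreal (exp (X k)))"
      by (intro prod_mono_ennreal that(1))
    also have "\<dots> = ennreal (exp (\<Sum>k<m. X k))"
      by (simp add: prod_ennreal exp_sum)
    finally show ?thesis using that by (simp add: ennreal_mult mult_right_mono)
  qed
  let ?P = "\<lambda>x. \<Prod>k<m. block (E k) (x (2*k+1)) (x (2*k+2)) (x (2*k+3))"
  let ?M = "Pi\<^sub>M {1..2*m+1} (\<lambda>_. lborel :: complex measure)"
  have \<alpha>': "(\<lambda>x. ennreal (\<alpha> x powr (1 / v))) \<in> borel_measurable borel"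
    and \<beta>': "(\<lambda>x. ennreal (\<beta> x powr (1 / w))) \<in> borel_measurable borel" by measurable
  have "(\<integral>\<^sup>+x. ?P x * ennreal (\<alpha> (x (2*m+1)) powr (1 / v)) \<partial>?M)
      = chain_form m E (\<lambda>x t. ennreal (\<alpha> x powr (1 / v)))"
    by (simp only: chain_form_def)
  also have "\<dots> \<le> (\<Prod>k<m. spoke_cost (?e k)) * ennreal A"
    using chain_form_fst_le[of E ?e, OF E size \<alpha>'] by (simp only: A)
  also have "\<dots> \<le> ennreal (exp (\<Sum>k<m. S k) * A)"
    by (rule prod_le[OF costs(1) A(2)])
  finally have spoke: "(\<integral>\<^sup>+x. ?P x * ennreal (\<alpha> (x (2*m+1)) powr (1 / v)) \<partial>?M) \<le> ennreal (exp (\<Sum>k<m. S k) * A)" .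
  have chain_\<beta>: "(\<integral>\<^sup>+x. ?P x * ennreal (\<beta> (alt_sum (2*m+1) x) powr (1 / w)) \<partial>?M)
      = chain_form m E (\<lambda>x t. ennreal (\<beta> t powr (1 / w)))"
    by (simp only: chain_form_def)
  have "(\<integral>\<^sup>+x. ennreal (\<beta> (z + x) powr (1 / w)) \<partial>lborel) \<le> ennreal B" for z
    using nn_integral_lborel_translate[OF \<beta>', of z] B(1) by (simp add: add.commute)
  note diag = this
  have "chain_form m E (\<lambda>x t. ennreal (\<beta> t powr (1 / w))) \<le> (\<Prod>k<m. forward_cost (?e k)) * ennreal B"
    by (rule chain_form_forward_le[of E ?e, OF E size plane_measurable_snd[OF \<beta>'] diag])
  also have "\<dots> \<le> ennreal (exp (\<Sum>k<m. F k) * B)"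
    by (rule prod_le[OF costs(2) B(2)])
  finally have forward: "chain_form m E (\<lambda>x t. ennreal (\<beta> t powr (1 / w))) \<le> ennreal (exp (\<Sum>k<m. F k) * B)" .
  have "chain_form m E (\<lambda>x t. ennreal (\<beta> t powr (1 / w))) \<le> (\<Prod>k<m. backward_cost (?e k)) * ennreal B"
    by (rule chain_form_backward_le[of E ?e, OF E size plane_measurable_snd[OF \<beta>'] diag eq_refl[OF B(1)]])
  also have "\<dots> \<le> ennreal (exp (\<Sum>k<m. G k) * B)"
    by (rule prod_le[OF costs(3) B(2)])
  finally have backward: "chain_form m E (\<lambda>x t. ennreal (\<beta> t powr (1 / w))) \<le> ennreal (exp (\<Sum>k<m. G k) * B)" .
  define Y where "Y = min (\<Sum>k<m. F k) (\<Sum>k<m. G k)"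
  have \<beta>_le: "(\<integral>\<^sup>+x. ?P x * ennreal (\<beta> (alt_sum (2*m+1) x) powr (1 / w)) \<partial>?M) \<le> ennreal (exp Y * B)"
    using forward backward unfolding chain_\<beta> Y_def by (auto simp: min_def)
  have coord: "(\<lambda>x. x i) \<in> borel_measurable ?M" if "i \<in> {1..2*m+1}" for i
    using coordinate_borel[OF that] .
  have "chain_form m E (\<lambda>x t. ennreal (\<alpha> x) * ennreal (\<beta> t))
      = (\<integral>\<^sup>+x. ?P x * (ennreal (\<alpha> (x (2*m+1))) * ennreal (\<beta> (alt_sum (2*m+1) x))) \<partial>?M)"
    by (simp only: chain_form_def)
  also have "\<dots> \<le> ennreal ((exp (\<Sum>k<m. S k) * A) powr v * (exp Y * B) powr w)"
  proof (rule nn_integral_Hoelder_bound[OF _ _ _ nonneg(1) nonneg(2) _ _ vw(3) spoke _ \<beta>_le])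
    show "(\<lambda>x. \<alpha> (x (2*m+1))) \<in> borel_measurable ?M"
      by (rule measurable_compose[OF coord \<alpha>]) simp
    show "(\<lambda>x. \<beta> (alt_sum (2*m+1) x)) \<in> borel_measurable ?M"
      by (rule measurable_compose[OF measurable_alt_sum \<beta>]) simp
    show "?P \<in> borel_measurable ?M"
      by (intro borel_measurable_prod_ennreal measurable_block coord allI E) auto
  qed (use vw A B in auto)
  also have "(exp (\<Sum>k<m. S k) * A) powr v * (exp Y * B) powr w
      = A powr v * B powr w * exp (v * (\<Sum>k<m. S k) + w * Y)"
    using A B by (simp add: powr_mult exp_powr_real exp_add mult_ac)
  also have "\<dots> \<le> A powr v * B powr w * exp (\<Sum>k<m. (\<Sum>i=1..4. \<tau> k i * n k i) - \<epsilon> * spread (n k))"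
  proof (intro mult_left_mono iffD2[OF exp_le_cancel_iff])
    \<comment> \<open>The exponent \<open>w\<close> of the chain with \<open>\<beta>\<close> is shared between the forward and the backward bound.\<close>
    have "(4/5 - v) * Y \<le> (4/5 - v) * (\<Sum>k<m. F k)" "1/5 * Y \<le> 1/5 * (\<Sum>k<m. G k)"
      using vw by (intro mult_left_mono; simp add: Y_def)+
    moreover have "w = (4/5 - v) + 1/5" using vw by simp
    then have "w * Y = (4/5 - v) * Y + 1/5 * Y" by (simp only: distrib_right)
    ultimately have "v * (\<Sum>k<m. S k) + w * Y \<le> v * (\<Sum>k<m. S k) + ((4/5 - v) * (\<Sum>k<m. F k) + 1/5 * (\<Sum>k<m. G k))"
      by linarith
    also have "\<dots> = (\<Sum>k<m. v * S k + (4/5 - v) * F k + 1/5 * G k)"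
      by (simp add: sum.distrib sum_distrib_left)
    also have "\<dots> \<le> (\<Sum>k<m. (\<Sum>i=1..4. \<tau> k i * n k i) - \<epsilon> * spread (n k))"
      by (intro sum_mono gain) auto
    finally show "v * (\<Sum>k<m. S k) + w * Y \<le> (\<Sum>k<m. (\<Sum>i=1..4. \<tau> k i * n k i) - \<epsilon> * spread (n k))" .
  qed auto
  finally show ?thesis
    by (simp add: ennreal_mult prod_nonneg ennreal_leI prod_ennreal exp_sum)
qed

section \<open>Sums over the integers\<close>

text \<open>Sums of extended nonnegative numbers, written as integrals so that the theorems of Fubini and Tonelli
  apply to sums and integrals alike.\<close>

abbreviation sum_over :: "('a \<Rightarrow> ennreal) \<Rightarrow> ennreal" where
  "sum_over f \<equiv> \<integral>\<^sup>+i. f i \<partial>count_space UNIV"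

lemma sum_over_int_shift: "(\<integral>\<^sup>+i. f (i + k) \<partial>count_space UNIV) = sum_over (f :: int \<Rightarrow> ennreal)"
  by (rule nn_integral_bij_count_space) (rule bij_betwI[of _ _ _ "\<lambda>i. i - k"], auto)

lemma sum_over_swap:
  "(\<integral>\<^sup>+i. \<integral>\<^sup>+j. f i j \<partial>count_space UNIV \<partial>count_space UNIV)
   = (\<integral>\<^sup>+j. \<integral>\<^sup>+i. f i j \<partial>count_space UNIV \<partial>count_space UNIV)"
  using nn_integral_fst_count_space[of "\<lambda>(i, j). f i j"] nn_integral_snd_count_space[of "\<lambda>(i, j). f i j"]
  by simp

text \<open>A sequence in the unit ball of \<open>\<ell>\<^sup>q\<close>. The bound by \<open>1\<close> follows from the other condition if \<open>0 < q < \<infinity>\<close> and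
  is the whole condition if \<open>q = \<infinity>\<close>.\<close>

definition lq_bounded :: "ennreal \<Rightarrow> (int \<Rightarrow> real) \<Rightarrow> bool" where
  "lq_bounded q b \<longleftrightarrow> (\<forall>n. 0 \<le> b n \<and> b n \<le> 1) \<and>
     (q \<noteq> \<infinity> \<longrightarrow> (\<integral>\<^sup>+n. ennreal (b n powr enn2real q) \<partial>count_space UNIV) \<le> 1)"

text \<open>Weighted inequality of arithmetic and geometric means, by convexity of the exponential function.\<close>

lemma prod_le_weighted_sum:
  fixes l y :: "'i \<Rightarrow> real"
  assumes "finite I" "\<And>i. i \<in> I \<Longrightarrow> 0 \<le> l i" "(\<Sum>i\<in>I. l i) = 1" "\<And>i. i \<in> I \<Longrightarrow> 0 < y i"
  shows "(\<Prod>i\<in>I. y i powr l i) \<le> (\<Sum>i\<in>I. l i * y i)"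
proof -
  have "(\<Prod>i\<in>I. y i powr l i) = exp (\<Sum>i\<in>I. l i * ln (y i))"
    unfolding exp_sum[OF assms(1)] by (intro prod.cong refl) (simp add: powr_def assms(4)[THEN less_imp_neq, symmetric])
  also have "\<dots> \<le> (\<Sum>i\<in>I. l i * exp (ln (y i)))"
    using convex_on_sum[OF assms(1) _ exp_convex assms(3), of "\<lambda>i. ln (y i)"] assms by (cases "I = {}") auto
  also have "\<dots> = (\<Sum>i\<in>I. l i * y i)" using assms by (intro sum.cong) auto
  finally show ?thesis .
qed

text \<open>The multilinear Hoelder inequality in \<open>\<ell>\<^sup>q\<close>, also for \<open>\<Sum> 1/q\<^sub>i > 1\<close> and for \<open>q\<^sub>i < 1\<close>. With
  \<open>T = \<Sum> 1/q\<^sub>i\<close> the weights \<open>1 / (q\<^sub>i T)\<close> have sum \<open>1\<close>, and since \<open>b\<^sub>i \<le> 1\<close> and \<open>T \<ge> 1\<close>, \<open>b\<^sub>i\<close> is at most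
  the power of \<open>b\<^sub>i\<^sup>q\<close> with this weight. So no constant depending on \<open>q\<close> appears.\<close>

lemma sum_prod_shift_le_1:
  fixes q :: "nat \<Rightarrow> ennreal" and b :: "nat \<Rightarrow> int \<Rightarrow> real" and s :: "nat \<Rightarrow> int"
  assumes I: "finite I" and q: "\<And>i. i \<in> I \<Longrightarrow> 0 < q i" and dual: "1 \<le> (\<Sum>i\<in>I. 1 / q i)"
    and b: "\<And>i. i \<in> I \<Longrightarrow> lq_bounded (q i) (b i)"
  shows "(\<integral>\<^sup>+n. (\<Prod>i\<in>I. ennreal (b i (n + s i))) \<partial>count_space UNIV) \<le> 1"
proof -
  define J where "J = {i \<in> I. q i \<noteq> \<infinity>}"
  define r where "r i = enn2real (q i)" for i
  define T where "T = (\<Sum>i\<in>J. 1 / r i)"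
  define l where "l i = 1 / r i / T" for i
  have J: "finite J" "J \<subseteq> I" using I by (auto simp: J_def)
  have r: "0 < r i" "q i = ennreal (r i)" if "i \<in> J" for i
    using that q[of i] by (auto simp: J_def r_def enn2real_positive_iff less_top)
  have "(\<Sum>i\<in>I. 1 / q i) = (\<Sum>i\<in>J. 1 / q i)"
    using I by (intro sum.mono_neutral_right) (auto simp: J_def)
  also have "\<dots> = (\<Sum>i\<in>J. ennreal (1 / r i))"
    using r by (intro sum.cong) (auto simp: divide_ennreal simp flip: ennreal_1)
  also have "\<dots> = ennreal T"
    unfolding T_def using r by (intro sum_ennreal) (auto intro: less_imp_le)
  finally have T: "1 \<le> T" using dual by simp
  have l: "0 \<le> l i" if "i \<in> J" for i using r[OF that] T by (simp add: l_def)
  have suml: "(\<Sum>i\<in>J. l i) = 1"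
    using T unfolding l_def sum_divide_distrib[symmetric] T_def[symmetric] by simp
  have pw: "(\<Prod>i\<in>I. b i (n i)) \<le> (\<Sum>i\<in>J. l i * b i (n i) powr r i)" for n :: "nat \<Rightarrow> int"
  proof -
    have b01: "0 \<le> b i (n i)" "b i (n i) \<le> 1" if "i \<in> I" for i
      using b[OF that] unfolding lq_bounded_def by auto
    have rhs: "0 \<le> (\<Sum>i\<in>J. l i * b i (n i) powr r i)"
      using l by (intro sum_nonneg) auto
    show ?thesis
    proof (cases "\<exists>i\<in>I. b i (n i) = 0")
      case True
      then have "(\<Prod>i\<in>I. b i (n i)) = 0" using I by (simp add: prod_zero_iff)
      then show ?thesis using rhs by simp
    next
      case False
      with b01 have pos: "0 < b i (n i)" if "i \<in> I" for i using that by (metis less_le)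
      \<comment> \<open>The factors with \<open>q i = \<infinity>\<close> are dropped.\<close>
      have "(\<Prod>i\<in>I. b i (n i)) = (\<Prod>i\<in>J. b i (n i)) * (\<Prod>i\<in>I - J. b i (n i))"
        using I J by (simp add: prod.subset_diff mult.commute)
      also have "\<dots> \<le> (\<Prod>i\<in>J. b i (n i)) * 1"
        using b01 J by (intro mult_left_mono prod_le_1 prod_nonneg) auto
      also have "\<dots> \<le> (\<Prod>i\<in>J. (b i (n i) powr r i) powr l i)"
        unfolding mult_1_right
      proof (intro prod_mono conjI)
        fix i assume i: "i \<in> J"
        then have iI: "i \<in> I" using J by auto
        show "0 \<le> b i (n i)" using b01[OF iI] by simp
        have "b i (n i) = b i (n i) powr 1" using pos[OF iI] by simp
        also have "\<dots> \<le> b i (n i) powr (1 / T)"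
          using pos[OF iI] b01[OF iI] T by (intro powr_mono') auto
        also have "1 / T = r i * l i" using r[OF i] by (simp add: l_def)
        finally show "b i (n i) \<le> (b i (n i) powr r i) powr l i" by (simp add: powr_powr)
      qed
      also have "\<dots> \<le> (\<Sum>i\<in>J. l i * b i (n i) powr r i)"
      proof (rule prod_le_weighted_sum[OF J(1) l suml])
        show "0 < b i (n i) powr r i" if "i \<in> J" for i using pos[of i] J that by auto
      qed
      finally show ?thesis .
    qed
  qed
  have "(\<integral>\<^sup>+n. (\<Prod>i\<in>I. ennreal (b i (n + s i))) \<partial>count_space UNIV)
      \<le> (\<integral>\<^sup>+n. (\<Sum>i\<in>J. ennreal (l i) * ennreal (b i (n + s i) powr r i)) \<partial>count_space UNIV)"
  proof (rule nn_integral_mono)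
    fix n
    have "(\<Prod>i\<in>I. ennreal (b i (n + s i))) = ennreal (\<Prod>i\<in>I. b i (n + s i))"
      using b by (intro prod_ennreal) (auto simp: lq_bounded_def)
    also have "\<dots> \<le> ennreal (\<Sum>i\<in>J. l i * b i (n + s i) powr r i)"
      by (intro ennreal_leI pw)
    also have "\<dots> = (\<Sum>i\<in>J. ennreal (l i) * ennreal (b i (n + s i) powr r i))"
      using l by (simp add: ennreal_mult flip: sum_ennreal)
    finally show "(\<Prod>i\<in>I. ennreal (b i (n + s i))) \<le> (\<Sum>i\<in>J. ennreal (l i) * ennreal (b i (n + s i) powr r i))" .
  qed
  also have "\<dots> = (\<Sum>i\<in>J. ennreal (l i) * (\<integral>\<^sup>+n. ennreal (b i n powr r i) \<partial>count_space UNIV))"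
    by (simp add: nn_integral_sum nn_integral_cmult
        sum_over_int_shift[of "\<lambda>n. ennreal (b i n powr r i)" for i])
  also have "\<dots> \<le> (\<Sum>i\<in>J. ennreal (l i) * 1)"
    using b J by (intro sum_mono mult_left_mono) (auto simp: J_def lq_bounded_def r_def)
  also have "\<dots> = ennreal (\<Sum>i\<in>J. l i)" using l by simp
  finally show ?thesis by (simp add: suml)
qed

text \<open>Summing along the diagonals first: the decay in the differences does not change along a diagonal.\<close>

lemma sum4_shift_decay:
  fixes b :: "nat \<Rightarrow> int \<Rightarrow> ennreal" and g :: "int \<Rightarrow> ennreal"
  assumes le: "\<And>k2 k3 k4. (\<integral>\<^sup>+n. b 1 n * b 2 (n + k2) * b 3 (n + k3) * b 4 (n + k4) \<partial>count_space UNIV) \<le> C"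
  shows "(\<integral>\<^sup>+n1. \<integral>\<^sup>+n2. \<integral>\<^sup>+n3. \<integral>\<^sup>+n4. g (n2 - n1) * g (n3 - n1) * g (n4 - n1)
      * (b 1 n1 * b 2 n2 * b 3 n3 * b 4 n4)
      \<partial>count_space UNIV \<partial>count_space UNIV \<partial>count_space UNIV \<partial>count_space UNIV) \<le> sum_over g ^ 3 * C"
proof -
  let ?h = "\<lambda>n1 n2 n3 n4. g (n2 - n1) * g (n3 - n1) * g (n4 - n1) * (b 1 n1 * b 2 n2 * b 3 n3 * b 4 n4)"
  have "(\<integral>\<^sup>+n1. \<integral>\<^sup>+n2. \<integral>\<^sup>+n3. \<integral>\<^sup>+n4. ?h n1 n2 n3 n4
      \<partial>count_space UNIV \<partial>count_space UNIV \<partial>count_space UNIV \<partial>count_space UNIV)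
    = (\<integral>\<^sup>+n1. \<integral>\<^sup>+k2. \<integral>\<^sup>+k3. \<integral>\<^sup>+k4. ?h n1 (k2 + n1) (k3 + n1) (k4 + n1)
      \<partial>count_space UNIV \<partial>count_space UNIV \<partial>count_space UNIV \<partial>count_space UNIV)"
    using sum_over_int_shift[of "\<lambda>n2. \<integral>\<^sup>+n3. \<integral>\<^sup>+n4. ?h n1 n2 n3 n4 \<partial>count_space UNIV \<partial>count_space UNIV" n1 for n1]
      sum_over_int_shift[of "\<lambda>n3. \<integral>\<^sup>+n4. ?h n1 n2 n3 n4 \<partial>count_space UNIV" n1 for n1 n2]
      sum_over_int_shift[of "\<lambda>n4. ?h n1 n2 n3 n4" n1 for n1 n2 n3]
    by (simp only: )
  also have "\<dots> = (\<integral>\<^sup>+k2. \<integral>\<^sup>+k3. \<integral>\<^sup>+k4. \<integral>\<^sup>+n1. ?h n1 (k2 + n1) (k3 + n1) (k4 + n1)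
      \<partial>count_space UNIV \<partial>count_space UNIV \<partial>count_space UNIV \<partial>count_space UNIV)"
    apply (subst sum_over_swap)
    apply (rule nn_integral_cong)
    apply (subst sum_over_swap)
    apply (rule nn_integral_cong)
    apply (rule sum_over_swap)
    done
  also have "\<dots> = (\<integral>\<^sup>+k2. \<integral>\<^sup>+k3. \<integral>\<^sup>+k4. g k2 * g k3 * g k4
      * (\<integral>\<^sup>+n. b 1 n * b 2 (n + k2) * b 3 (n + k3) * b 4 (n + k4) \<partial>count_space UNIV)
      \<partial>count_space UNIV \<partial>count_space UNIV \<partial>count_space UNIV)"
    by (simp add: nn_integral_cmult add.commute)
  also have "\<dots> \<le> (\<integral>\<^sup>+k2. \<integral>\<^sup>+k3. \<integral>\<^sup>+k4. g k2 * g k3 * g k4 * C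
      \<partial>count_space UNIV \<partial>count_space UNIV \<partial>count_space UNIV)"
    by (intro nn_integral_mono mult_left_mono le) auto
  also have "\<dots> = sum_over g ^ 3 * C"
    by (simp add: nn_integral_cmult nn_integral_multc power3_eq_cube mult_ac)
  finally show ?thesis .
qed

lemma geometric_sum_finite:
  assumes "0 < c"
  shows "(\<integral>\<^sup>+k. ennreal (exp (- c * \<bar>real_of_int k\<bar>)) \<partial>count_space UNIV) < \<infinity>"
proof -
  let ?g = "\<lambda>k. ennreal (exp (- c * \<bar>real_of_int k\<bar>))"
  have *: "(\<integral>\<^sup>+n. ennreal (exp (- c * real n)) \<partial>count_space UNIV) < \<infinity>"
  proof -
    have "summable (\<lambda>n. exp (- c) ^ n)" using assms by (intro summable_geometric) auto
    then have "summable (\<lambda>n. exp (- c * real n))"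
      by (simp add: mult.commute flip: exp_of_nat_mult)
    then show ?thesis
      by (simp add: nn_integral_count_space_nat suminf_ennreal2 less_top[symmetric])
  qed
  have "sum_over ?g = (\<integral>\<^sup>+k. ?g k * indicator {0..} k + ?g k * indicator {..<0} k \<partial>count_space UNIV)"
    by (intro nn_integral_cong) (auto simp: indicator_def)
  also have "\<dots> = (\<integral>\<^sup>+k. ?g k \<partial>count_space {0..}) + (\<integral>\<^sup>+k. ?g k \<partial>count_space {..<0})"
    by (simp add: nn_integral_add nn_integral_count_space_indicator)
  also have "(\<integral>\<^sup>+k. ?g k \<partial>count_space {0..}) = (\<integral>\<^sup>+n. ?g (int n) \<partial>count_space UNIV)"
    by (rule nn_integral_bij_count_space[symmetric], rule bij_betwI[of _ _ _ nat]) auto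
  also have "(\<integral>\<^sup>+k. ?g k \<partial>count_space {..<0}) = (\<integral>\<^sup>+n. ?g (- int n - 1) \<partial>count_space UNIV)"
    by (rule nn_integral_bij_count_space[symmetric], rule bij_betwI[of _ _ _ "\<lambda>k. nat (- k - 1)"]) auto
  also have "\<dots> \<le> (\<integral>\<^sup>+n. ennreal (exp (- c * real n)) \<partial>count_space UNIV)"
    using assms by (intro nn_integral_mono ennreal_leI) auto
  finally have "sum_over ?g \<le> (\<integral>\<^sup>+n. ennreal (exp (- c * real n)) \<partial>count_space UNIV)
      + (\<integral>\<^sup>+n. ennreal (exp (- c * real n)) \<partial>count_space UNIV)"
    by simp
  also have "\<dots> < \<infinity>" using * by simp
  finally show ?thesis .
qed

section \<open>Decreasing rearrangements and level sets\<close>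

lemma decr_rearrangement_antimono:
  assumes "s \<le> s'"
  shows "decr_rearrangement a s' \<le> decr_rearrangement a s"
  unfolding decr_rearrangement_def
proof (rule Inf_superset_mono, clarify)
  fix t :: real
  assume "0 \<le> t" "emeasure lebesgue {z. t < cmod (a z)} \<le> ennreal s"
  then show "\<exists>t'. ennreal t = ennreal t' \<and> 0 \<le> t' \<and> emeasure lebesgue {z. t' < cmod (a z)} \<le> ennreal s'"
    using order_trans[OF _ ennreal_leI[OF assms]] by (intro exI[of _ t]) simp
qed

text \<open>The infimum defining the rearrangement is attained, by continuity of the measure from below.\<close>

lemma emeasure_above_rearrangement_le:
  assumes a[measurable]: "a \<in> borel_measurable lebesgue"
  shows "emeasure lebesgue {z. decr_rearrangement a s < ennreal (cmod (a z))} \<le> ennreal s"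
proof (cases "decr_rearrangement a s")
  case top
  then show ?thesis by simp
next
  case (real r)
  define D where "D j = {z. r + 1 / real (Suc j) < cmod (a z)}" for j
  have D[measurable]: "D j \<in> sets lebesgue" for j
  proof -
    have "D j = {z \<in> space lebesgue. r + 1 / real (Suc j) < cmod (a z)}" by (simp add: D_def)
    also have "\<dots> \<in> sets lebesgue" by measurable
    finally show ?thesis .
  qed
  have "{z. decr_rearrangement a s < ennreal (cmod (a z))} = (\<Union>j. D j)"
  proof -
    have "(r < x) = (\<exists>j. r + 1 / real (Suc j) < x)" for x
    proof
      assume "r < x"
      then obtain j where "1 / real (Suc j) < x - r"
        using nat_approx_posE[of "x - r"] by auto
      then show "\<exists>j. r + 1 / real (Suc j) < x" by (intro exI[of _ j]) linarith
    next
      assume "\<exists>j. r + 1 / real (Suc j) < x"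
      then obtain j where "r + 1 / real (Suc j) < x" ..
      moreover have "0 < 1 / real (Suc j)" by simp
      ultimately show "r < x" by linarith
    qed
    then show ?thesis using real by (auto simp: D_def ennreal_less_iff)
  qed
  also have "emeasure lebesgue \<dots> = (SUP j. emeasure lebesgue (D j))"
  proof (rule SUP_emeasure_incseq[symmetric])
    show "incseq D"
    proof (rule incseq_SucI)
      fix j
      have "1 / real (Suc (Suc j)) \<le> 1 / real (Suc j)" by (simp add: frac_le)
      then show "D j \<subseteq> D (Suc j)" unfolding D_def by auto
    qed
  qed auto
  also have "\<dots> \<le> ennreal s"
  proof (rule SUP_least)
    fix j
    have "decr_rearrangement a s < ennreal (r + 1 / real (Suc j))"
      using real by (simp add: ennreal_less_iff)
    then obtain t where t: "0 \<le> t" "emeasure lebesgue {z. t < cmod (a z)} \<le> ennreal s"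
        "ennreal t < ennreal (r + 1 / real (Suc j))"
      unfolding decr_rearrangement_def Inf_less_iff by auto
    have "{z. t < cmod (a z)} = {z \<in> space lebesgue. t < cmod (a z)}" by simp
    also have "\<dots> \<in> sets lebesgue" by measurable
    finally have "emeasure lebesgue (D j) \<le> emeasure lebesgue {z. t < cmod (a z)}"
      using t by (intro emeasure_mono) (auto simp: D_def ennreal_less_iff)
    then show "emeasure lebesgue (D j) \<le> ennreal s" using t(2) by simp
  qed
  finally show ?thesis .
qed

lemma ennpowr_mono:
  assumes "x \<le> y" "0 \<le> p"
  shows "ennpowr x p \<le> ennpowr y p"
proof (cases "y = \<infinity>")
  case False
  then have "x \<noteq> \<infinity>" "enn2real x \<le> enn2real y"
    using assms by (auto simp: top_unique less_top intro: enn2real_mono)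
  then show ?thesis
    using False assms by (auto simp: ennpowr_def intro!: ennreal_leI powr_mono2)
qed (simp add: ennpowr_def)

lemma ennpowr_le_cancel:
  assumes "ennpowr x p \<le> ennpowr y p" "0 < p"
  shows "x \<le> y"
proof (rule ccontr)
  assume "\<not> x \<le> y"
  then have yx: "y < x" by simp
  then have y: "y \<noteq> \<infinity>" using less_top_ennreal by auto
  have "ennpowr y p < ennpowr x p"
  proof (cases "x = \<infinity>")
    case True
    then show ?thesis using y by (simp add: ennpowr_def)
  next
    case False
    then have "enn2real y < enn2real x"
      using yx y by (cases x; cases y) (auto simp: ennreal_less_iff)
    then show ?thesis
      using False y assms(2) by (auto simp: ennpowr_def ennreal_less_iff powr_less_mono2)
  qed
  with assms show False by simp
qed

text \<open>This is why the level sets are taken at the powers of \<open>e\<close>: the intervals have mass exactly \<open>1\<close> for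
  \<open>ds / s\<close>. For another base the mass would enter to the power \<open>-1/q\<close>, which is unbounded as \<open>q\<close> tends to \<open>0\<close>
  if the mass is smaller than \<open>1\<close>.\<close>

lemma nn_integral_reciprocal_exp_interval:
  "(\<integral>\<^sup>+s. indicator {exp (x - 1)<..exp x} s * ennreal (1 / s) \<partial>lborel) = 1"
proof -
  have "(\<integral>\<^sup>+s. indicator {exp (x - 1)<..exp x} s * ennreal (1 / s) \<partial>lborel)
      = (\<integral>\<^sup>+s. ennreal (1 / s) * indicator {exp (x - 1)..exp x} s \<partial>lborel)"
    using AE_lborel_singleton[of "exp (x - 1)"]
    by (intro nn_integral_cong_AE) (auto simp: indicator_def elim!: eventually_mono)
  also have "\<dots> = ennreal (ln (exp x) - ln (exp (x - 1)))"
  proof (rule nn_integral_FTC_Icc)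
    fix s assume "s \<in> {exp (x - 1)..exp x}"
    then have "0 < s" by (auto intro: less_le_trans[OF exp_gt_zero])
    then show "(ln has_real_derivative 1 / s) (at s)"
      by (auto intro!: derivative_eq_intros)
    from \<open>0 < s\<close> show "0 \<le> 1 / s" by simp
  qed auto
  finally show ?thesis by simp
qed

text \<open>On the interval from \<open>exp (n - 1)\<close> to \<open>exp n\<close> the factor \<open>s powr \<theta>\<close> is smallest at the left end and the
  rearrangement at the right end, so that this value is a lower bound for their product.\<close>

definition sampled :: "real \<Rightarrow> (complex \<Rightarrow> complex) \<Rightarrow> int \<Rightarrow> ennreal" where
  "sampled \<theta> a n = ennreal (exp (\<theta> * (of_int n - 1))) * decr_rearrangement a (exp (of_int n))"

lemma sampled_le:
  assumes s: "exp (of_int n - 1) < s" "s \<le> exp (of_int n)" and "0 \<le> \<theta>"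
  shows "sampled \<theta> a n \<le> ennreal (s powr \<theta>) * decr_rearrangement a s"
proof -
  have "exp (\<theta> * (of_int n - 1)) = exp (of_int n - 1) powr \<theta>"
    by (simp add: exp_powr_real mult.commute)
  also have "\<dots> \<le> s powr \<theta>" using assms by (intro powr_mono2) auto
  finally show ?thesis
    unfolding sampled_def using s by (intro mult_mono ennreal_leI decr_rearrangement_antimono) auto
qed

text \<open>The \<open>\<ell>\<^sup>q\<close> quasi-norm of the samples is at most the Lorentz quasi-norm, without a constant. The bound for a
  single sample is the case \<open>q = \<infinity>\<close>, and for finite \<open>q\<close> it is one term of the sum.\<close>

lemma sampled_lq_bound:
  assumes \<theta>: "0 \<le> \<theta>" and q: "0 < q"
  shows "sampled \<theta> a n \<le> lorentz_norm \<theta> q a"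
    and "q \<noteq> \<infinity> \<Longrightarrow> sum_over (\<lambda>n. ennpowr (sampled \<theta> a n) (enn2real q)) \<le> ennpowr (lorentz_norm \<theta> q a) (enn2real q)"
proof -
  define r where "r = enn2real q"
  have sum: "sum_over (\<lambda>n. ennpowr (sampled \<theta> a n) r) \<le> ennpowr (lorentz_norm \<theta> q a) r" if fin: "q \<noteq> \<infinity>"
  proof -
    have r: "0 < r" using q fin by (simp add: r_def enn2real_positive_iff less_top)
    define h where "h s = ennpowr (ennreal (s powr \<theta>) * decr_rearrangement a s) r" for s
    define I where "I = (\<integral>\<^sup>+s\<in>{0<..}. (h s * ennreal (1 / s)) \<partial>lborel)"
    let ?J = "\<lambda>n::int. {exp (of_int n - 1)<..exp (of_int n :: real)}"
    let ?c = "\<lambda>n. ennpowr (sampled \<theta> a n) r"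
    have "sum_over ?c = (\<integral>\<^sup>+n. ?c n * (\<integral>\<^sup>+s. indicator (?J n) s * ennreal (1 / s) \<partial>lborel) \<partial>count_space UNIV)"
      by (simp add: nn_integral_reciprocal_exp_interval)
    also have "\<dots> = (\<integral>\<^sup>+n. \<integral>\<^sup>+s. ?c n * (indicator (?J n) s * ennreal (1 / s)) \<partial>lborel \<partial>count_space UNIV)"
      by (simp add: nn_integral_cmult)
    also have "\<dots> = (\<integral>\<^sup>+s. \<integral>\<^sup>+n. ?c n * (indicator (?J n) s * ennreal (1 / s)) \<partial>count_space UNIV \<partial>lborel)"
      by (rule nn_integral_count_space_nn_integral[symmetric]) auto
    also have "\<dots> \<le> I"
      unfolding I_def
    proof (rule nn_integral_mono)
      fix s :: real
      show "(\<integral>\<^sup>+n. ?c n * (indicator (?J n) s * ennreal (1 / s)) \<partial>count_space UNIV)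
        \<le> h s * ennreal (1 / s) * indicator {0<..} s"
      proof (cases "0 < s")
        case False
        then have "s \<notin> ?J n" for n by (auto dest: less_trans[OF exp_gt_zero])
        then show ?thesis by simp
      next
        case True
        have J: "s \<in> ?J n \<longleftrightarrow> n = \<lceil>ln s\<rceil>" for n
        proof -
          have "s \<in> ?J n \<longleftrightarrow> exp (of_int n - 1) < exp (ln s) \<and> exp (ln s) \<le> exp (of_int n)"
            using True by simp
          also have "\<dots> \<longleftrightarrow> of_int n - 1 < ln s \<and> ln s \<le> of_int n"
            by (simp only: exp_less_cancel_iff exp_le_cancel_iff)
          also have "\<dots> \<longleftrightarrow> n = \<lceil>ln s\<rceil>"
            using ceiling_eq_iff[of "ln s" n] by auto
          finally show ?thesis .
        qed
        have "(\<integral>\<^sup>+n. ?c n * (indicator (?J n) s * ennreal (1 / s)) \<partial>count_space UNIV)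
          = (\<integral>\<^sup>+n. ?c n * ennreal (1 / s) * indicator {\<lceil>ln s\<rceil>} n \<partial>count_space UNIV)"
          by (intro nn_integral_cong) (simp only: indicator_def J, simp)
        also have "\<dots> = ?c \<lceil>ln s\<rceil> * ennreal (1 / s)"
          by (simp add: nn_integral_indicator_finite)
        also have "\<dots> \<le> h s * ennreal (1 / s)"
          unfolding h_def
          using J[of "\<lceil>ln s\<rceil>"] r \<theta> by (intro mult_right_mono ennpowr_mono sampled_le) auto
        finally show ?thesis using True by simp
      qed
    qed
    finally have le: "sum_over ?c \<le> I" .
    have "ennpowr (lorentz_norm \<theta> q a) r = I"
    proof -
      have "lorentz_norm \<theta> q a = ennpowr I (1 / r)"
        using fin unfolding lorentz_norm_def I_def h_def r_def by simp
      moreover have "ennpowr (ennpowr I (1 / r)) r = I"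
        using r by (cases I) (auto simp: ennpowr_def powr_powr)
      ultimately show ?thesis by simp
    qed
    then show ?thesis using le by simp
  qed
  then show "sum_over (\<lambda>n. ennpowr (sampled \<theta> a n) (enn2real q)) \<le> ennpowr (lorentz_norm \<theta> q a) (enn2real q)"
    if "q \<noteq> \<infinity>" using that unfolding r_def by simp
  show "sampled \<theta> a n \<le> lorentz_norm \<theta> q a"
  proof (cases "q = \<infinity>")
    case True
    have "sampled \<theta> a n \<le> ennreal (exp (of_int n) powr \<theta>) * decr_rearrangement a (exp (of_int n))"
      using \<theta> by (intro sampled_le) auto
    also have "\<dots> \<le> lorentz_norm \<theta> q a"
      unfolding lorentz_norm_def using True by (auto intro!: SUP_upper)
    finally show ?thesis .
  next
    case False
    have r: "0 < r" using q False by (simp add: r_def enn2real_positive_iff less_top)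
    have "ennpowr (sampled \<theta> a n) r \<le> sum_over (\<lambda>n. ennpowr (sampled \<theta> a n) r)"
      by (rule nn_integral_ge_point) simp
    also note sum[OF False]
    finally show ?thesis by (rule ennpowr_le_cancel[OF _ r])
  qed
qed

lemma sampled_normalised:
  assumes \<theta>: "0 \<le> \<theta>" and q: "0 < q" and fin: "lorentz_norm \<theta> q a < \<infinity>"
  obtains b where "lq_bounded q b" "\<And>n. sampled \<theta> a n = lorentz_norm \<theta> q a * ennreal (b n)"
proof -
  obtain l where l: "lorentz_norm \<theta> q a = ennreal l" "0 \<le> l"
    using fin by (cases "lorentz_norm \<theta> q a") auto
  note bound = sampled_lq_bound[OF \<theta> q, of a]
  define y where "y n = enn2real (sampled \<theta> a n)" for n
  have y: "sampled \<theta> a n = ennreal (y n)" "0 \<le> y n" "y n \<le> l" for n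
  proof -
    have "sampled \<theta> a n < \<infinity>" using bound(1)[of n] fin by (rule le_less_trans)
    then show *: "sampled \<theta> a n = ennreal (y n)" "0 \<le> y n" by (simp_all add: y_def less_top)
    show "y n \<le> l" using bound(1)[of n] unfolding * l(1) using l(2) by simp
  qed
  define b where "b n = y n / l" for n
  have yb: "y n = l * b n" for n using y(2,3)[of n] by (cases "l = 0") (auto simp: b_def)
  have b: "0 \<le> b n" "b n \<le> 1" for n using y(2,3)[of n] l(2) by (auto simp: b_def divide_le_eq_1)
  have "lq_bounded q b"
    unfolding lq_bounded_def
  proof (intro conjI allI impI b)
    assume "q \<noteq> \<infinity>"
    define r where "r = enn2real q"
    have r: "0 < r" using q \<open>q \<noteq> \<infinity>\<close> by (simp add: r_def enn2real_positive_iff less_top)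
    show "sum_over (\<lambda>n. ennreal (b n powr enn2real q)) \<le> 1"
    proof (cases "l = 0")
      case True
      then show ?thesis by (simp add: b_def)
    next
      case False
      with l have lpos: "0 < l" by simp
      have "ennreal (l powr r) * sum_over (\<lambda>n. ennreal (b n powr r)) = sum_over (\<lambda>n. ennpowr (sampled \<theta> a n) r)"
      proof -
        have "ennpowr (sampled \<theta> a n) r = ennreal (l powr r) * ennreal (b n powr r)" for n
          unfolding y(1) yb using b[of n] l by (simp add: ennpowr_def powr_mult flip: ennreal_mult)
        then show ?thesis by (simp add: nn_integral_cmult)
      qed
      also have "\<dots> \<le> ennreal (l powr r) * 1"
        using bound(2)[OF \<open>q \<noteq> \<infinity>\<close>] l unfolding r_def[symmetric] by (simp add: ennpowr_def)
      finally show ?thesis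
        unfolding r_def[symmetric] using lpos by (subst (asm) ennreal_mult_le_mult_iff) auto
    qed
  qed
  moreover have "sampled \<theta> a n = lorentz_norm \<theta> q a * ennreal (b n)" for n
    using y(1) l yb b by (simp add: ennreal_mult)
  ultimately show ?thesis by (rule that)
qed

text \<open>Where \<open>a\<^sup>* (exp (n + 1)) < \<bar>a z\<bar> \<le> a\<^sup>* (exp n)\<close>, the term with index \<open>n\<close> alone dominates. If \<open>a z \<noteq> 0\<close>, such an \<open>n\<close>
  exists outside the null set where \<open>\<bar>a z\<bar>\<close> exceeds all values of the rearrangement, because
  \<open>a\<^sup>* (exp n)\<close> tends to \<open>0\<close> if the Lorentz quasi-norm is finite. The sets are chosen as Borel
  supersets, of the same measure, of the sets where only the first of the two inequalities holds; they
  overlap, which does no harm.\<close>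

lemma level_decomposition:
  assumes a[measurable]: "a \<in> borel_measurable lebesgue"
    and \<theta>: "0 < \<theta>" and q: "0 < q" and fin: "lorentz_norm \<theta> q a < \<infinity>"
  obtains E :: "int \<Rightarrow> complex set"
  where "\<And>n. E n \<in> sets borel" "\<And>n. emeasure lborel (E n) \<le> ennreal (exp (of_int n + 1))"
    and "AE z in lborel. ennreal (cmod (a z))
        \<le> sum_over (\<lambda>n. decr_rearrangement a (exp (of_int n)) * indicator (E n) z)"
proof -
  let ?r = "\<lambda>n::int. decr_rearrangement a (exp (of_int n))"
  define D where "D n = {z. ?r n < ennreal (cmod (a z))}" for n
  have D: "D n \<in> sets lebesgue" for n
  proof -
    have "D n = {z \<in> space lebesgue. ?r n < ennreal (cmod (a z))}" by (simp add: D_def)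
    also have "\<dots> \<in> sets lebesgue" by measurable
    finally show ?thesis .
  qed
  have Dsize: "emeasure lebesgue (D n) \<le> ennreal (exp (of_int n))" for n
    unfolding D_def by (rule emeasure_above_rearrangement_le[OF a])
  have "\<exists>E. E \<in> sets lborel \<and> D (n + 1) \<subseteq> E \<and> emeasure lebesgue (D (n + 1)) = emeasure lborel E" for n
    by (rule completion_upper[OF D[of "n + 1"]], intro exI conjI)
  from choice[OF allI[OF this]] obtain E where "\<forall>n. E n \<in> sets lborel \<and> D (n + 1) \<subseteq> E n
      \<and> emeasure lebesgue (D (n + 1)) = emeasure lborel (E n)" ..
  then have E: "E n \<in> sets lborel" "D (n + 1) \<subseteq> E n"
      "emeasure lebesgue (D (n + 1)) = emeasure lborel (E n)" for n
    by simp_all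
  \<comment> \<open>The measure of \<open>D n\<close> tends to \<open>0\<close> as \<open>n\<close> tends to \<open>-\<infinity>\<close>.\<close>
  have null: "AE z in lebesgue. z \<notin> (\<Inter>n. D n)"
  proof (rule AE_not_in)
    have "emeasure lebesgue (\<Inter>n. D n) \<le> 0"
    proof (rule ennreal_le_epsilon)
      fix e :: real assume "0 < e"
      define n where "n = \<lfloor>ln e\<rfloor>"
      have "emeasure lebesgue (\<Inter>n. D n) \<le> emeasure lebesgue (D n)"
        using D by (intro emeasure_mono) auto
      also have "\<dots> \<le> ennreal (exp (of_int n))" by (rule Dsize)
      also have "\<dots> \<le> ennreal (exp (ln e))" by (intro ennreal_leI) (simp add: n_def)
      finally show "emeasure lebesgue (\<Inter>n. D n) \<le> 0 + ennreal e" using \<open>0 < e\<close> by simp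
    qed
    then show "(\<Inter>n. D n) \<in> null_sets lebesgue"
      using D by (intro null_setsI) auto
  qed
  have cover: "ennreal (cmod (a z)) \<le> sum_over (\<lambda>n. ?r n * indicator (E n) z)" if z: "z \<notin> (\<Inter>n. D n)" for z
  proof (cases "a z = 0")
    case False
    obtain n1 where n1: "z \<notin> D n1" using z by auto
    obtain n0 where n0: "z \<in> D n0"
    proof -
      obtain l where l: "lorentz_norm \<theta> q a = ennreal l" "0 \<le> l"
        using fin by (cases "lorentz_norm \<theta> q a") auto
      define x where "x = cmod (a z)"
      have x: "0 < x" using False by (simp add: x_def)
      \<comment> \<open>chosen so that \<open>exp (\<theta> * (n - 1)) * x \<ge> l + 1\<close>\<close>
      define n where "n = \<lceil>ln ((l + 1) / x) / \<theta>\<rceil> + 1"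
      have "ln ((l + 1) / x) / \<theta> \<le> of_int n - 1" by (simp add: n_def)
      then have "ln ((l + 1) / x) \<le> \<theta> * (of_int n - 1)"
        using \<theta> by (simp add: divide_le_eq mult.commute)
      then have "exp (ln ((l + 1) / x)) \<le> exp (\<theta> * (of_int n - 1))" by simp
      moreover have "0 < (l + 1) / x" using x l by simp
      ultimately have "(l + 1) / x \<le> exp (\<theta> * (of_int n - 1))" by simp
      then have big: "l < exp (\<theta> * (of_int n - 1)) * x"
        using x by (simp add: divide_le_eq)
      have "ennreal (exp (\<theta> * (of_int n - 1))) * ?r n \<le> ennreal l"
        using sampled_lq_bound(1)[of \<theta> q a n] \<theta> q l by (simp add: sampled_def)
      also have "\<dots> < ennreal (exp (\<theta> * (of_int n - 1))) * ennreal x"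
        using big x l by (simp add: ennreal_less_iff flip: ennreal_mult)
      finally have "?r n < ennreal x"
        using mult_left_mono[of "ennreal x" "?r n" "ennreal (exp (\<theta> * (of_int n - 1)))"] by (auto simp flip: not_le)
      then show ?thesis using that[of n] by (simp add: D_def x_def)
    qed
    have mono: "z \<in> D n'" if "z \<in> D n" "n \<le> n'" for n n'
      using that decr_rearrangement_antimono[of "exp (of_int n)" "exp (of_int n')" a]
      unfolding D_def by (auto intro: le_less_trans)
    have "n1 < n0"
    proof (rule ccontr)
      assume "\<not> n1 < n0"
      then have "z \<in> D n1" by (intro mono[OF n0]) simp
      with n1 show False by contradiction
    qed
    have "z \<in> D (n1 + int (nat (n0 - n1)))" using n0 \<open>n1 < n0\<close> by simp
    from ex_least_nat_le[of "\<lambda>k. z \<in> D (n1 + int k)", OF this]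
    obtain k where k: "\<forall>i<k. z \<notin> D (n1 + int i)" "z \<in> D (n1 + int k)" by (elim exE conjE)
    have "k \<noteq> 0" using k(2) n1 by (intro notI) simp
    then have eq: "n1 + int (k - 1) + 1 = n1 + int k" by simp
    have "z \<notin> D (n1 + int (k - 1))" using \<open>k \<noteq> 0\<close> by (intro k(1)[rule_format]) simp
    moreover have "z \<in> D (n1 + int (k - 1) + 1)" unfolding eq by (rule k(2))
    moreover define n where "n = n1 + int (k - 1)"
    ultimately have n: "z \<notin> D n" "z \<in> D (n + 1)" by simp_all
    then have "ennreal (cmod (a z)) \<le> ?r n * indicator (E n) z"
      using E(2)[of n] by (auto simp: D_def not_less)
    also have "\<dots> \<le> sum_over (\<lambda>n. ?r n * indicator (E n) z)"
      by (rule nn_integral_ge_point) simp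
    finally show ?thesis .
  qed simp
  have "AE z in lebesgue. ennreal (cmod (a z)) \<le> sum_over (\<lambda>n. ?r n * indicator (E n) z)"
    using null by eventually_elim (rule cover)
  then have AE: "AE z in lborel. ennreal (cmod (a z)) \<le> sum_over (\<lambda>n. ?r n * indicator (E n) z)"
    by (simp only: AE_completion_iff)
  have "emeasure lborel (E n) \<le> ennreal (exp (of_int n + 1))" for n
    using Dsize[of "n + 1"] unfolding E(3) by simp
  with E(1) AE show ?thesis by (intro that[of E]) simp_all
qed

section \<open>Expanding products of sums\<close>

lemma borel_measurable_sum_over:
  fixes f :: "'j::countable \<Rightarrow> 'a \<Rightarrow> ennreal"
  assumes "\<And>j. f j \<in> borel_measurable M"
  shows "(\<lambda>x. sum_over (\<lambda>j. f j x)) \<in> borel_measurable M"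
proof -
  have "sum_over g = (\<Sum>n. g (from_nat n) * indicator (range (to_nat :: 'j \<Rightarrow> nat)) n)" for g :: "'j \<Rightarrow> ennreal"
  proof -
    have "sum_over g = (\<integral>\<^sup>+i. g (from_nat (to_nat (i :: 'j))) \<partial>count_space UNIV)" by simp
    also have "\<dots> = (\<integral>\<^sup>+n. g (from_nat n) \<partial>count_space (range (to_nat :: 'j \<Rightarrow> nat)))"
      by (rule nn_integral_bij_count_space) (simp add: bij_betw_def)
    also have "\<dots> = (\<Sum>n. g (from_nat n) * indicator (range (to_nat :: 'j \<Rightarrow> nat)) n)"
      by (simp add: nn_integral_count_space_indicator nn_integral_count_space_nat)
    finally show ?thesis .
  qed
  then show ?thesis using assms by simp
qed

text \<open>A bound that is multiplicative over the factors survives replacing each factor by a countable sum of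
  functions of this kind. This is what makes the blocks independent of each other.\<close>

lemma nn_integral_prod_sum_over_le:
  fixes \<beta> :: "nat \<Rightarrow> 'j::countable \<Rightarrow> 'a \<Rightarrow> ennreal"
  assumes \<beta>: "\<And>k j. k < m \<Longrightarrow> \<beta> k j \<in> borel_measurable M" and h: "h \<in> borel_measurable M"
    and le: "\<And>\<nu>. (\<integral>\<^sup>+x. (\<Prod>k<m. \<beta> k (\<nu> k) x) * h x \<partial>M) \<le> D * (\<Prod>k<m. N k (\<nu> k))"
  shows "(\<integral>\<^sup>+x. (\<Prod>k<m. sum_over (\<lambda>j. \<beta> k j x)) * h x \<partial>M) \<le> D * (\<Prod>k<m. sum_over (N k))"
  using \<beta> h le
proof (induction m arbitrary: h D)
  case 0
  then show ?case by simp
next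
  case (Suc m)
  note h = Suc.prems(2) and \<beta> = Suc.prems(1)
  have meas: "(\<lambda>x. sum_over (\<lambda>j. \<beta> k j x)) \<in> borel_measurable M" if "k < m" for k
    using that by (intro borel_measurable_sum_over \<beta>) simp
  have "(\<integral>\<^sup>+x. (\<Prod>k<Suc m. sum_over (\<lambda>j. \<beta> k j x)) * h x \<partial>M)
      = (\<integral>\<^sup>+x. sum_over (\<lambda>j. (\<Prod>k<m. sum_over (\<lambda>j. \<beta> k j x)) * (\<beta> m j x * h x)) \<partial>M)"
    by (simp add: nn_integral_cmult nn_integral_multc mult_ac)
  also have "\<dots> = (\<integral>\<^sup>+j. \<integral>\<^sup>+x. (\<Prod>k<m. sum_over (\<lambda>j. \<beta> k j x)) * (\<beta> m j x * h x) \<partial>M \<partial>count_space UNIV)"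
    by (intro nn_integral_count_space_nn_integral borel_measurable_times_ennreal borel_measurable_prod_ennreal
        meas \<beta> h) auto
  also have "\<dots> \<le> (\<integral>\<^sup>+j. (D * N m j) * (\<Prod>k<m. sum_over (N k)) \<partial>count_space UNIV)"
  proof (intro nn_integral_mono Suc.IH)
    show "\<beta> k j \<in> borel_measurable M" if "k < m" for k j using that by (intro \<beta>) simp
    fix j
    show "(\<lambda>x. \<beta> m j x * h x) \<in> borel_measurable M"
      by (intro borel_measurable_times_ennreal \<beta> h) simp
    fix \<nu> :: "nat \<Rightarrow> 'j"
    let ?\<nu> = "\<nu>(m := j)"
    have *: "(\<Prod>k<Suc m. f k (?\<nu> k)) = (\<Prod>k<m. f k (\<nu> k)) * f m j" for f :: "nat \<Rightarrow> 'j \<Rightarrow> ennreal"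
      by (simp add: prod.lessThan_Suc)
    have "(\<integral>\<^sup>+x. (\<Prod>k<m. \<beta> k (\<nu> k) x) * (\<beta> m j x * h x) \<partial>M) = (\<integral>\<^sup>+x. (\<Prod>k<Suc m. \<beta> k (?\<nu> k) x) * h x \<partial>M)"
      by (simp only: *[of "\<lambda>k j. \<beta> k j x" for x] mult.assoc)
    also have "\<dots> \<le> D * (\<Prod>k<Suc m. N k (?\<nu> k))" by (rule Suc.prems(3))
    also have "\<dots> = D * N m j * (\<Prod>k<m. N k (\<nu> k))" by (simp only: *) (simp only: mult_ac)
    finally show "(\<integral>\<^sup>+x. (\<Prod>k<m. \<beta> k (\<nu> k) x) * (\<beta> m j x * h x) \<partial>M) \<le> D * N m j * (\<Prod>k<m. N k (\<nu> k))" .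
  qed
  also have "\<dots> = D * (\<Prod>k<Suc m. sum_over (N k))"
    by (simp add: nn_integral_cmult nn_integral_multc mult_ac)
  finally show ?case .
qed

lemma sum_over_quadruples:
  "sum_over (\<lambda>(n1::int, n2::int, n3::int, n4::int). f n1 n2 n3 n4)
    = (\<integral>\<^sup>+n1. \<integral>\<^sup>+n2. \<integral>\<^sup>+n3. \<integral>\<^sup>+n4. f n1 n2 n3 n4
        \<partial>count_space UNIV \<partial>count_space UNIV \<partial>count_space UNIV \<partial>count_space UNIV)"
  by (simp flip: nn_integral_fst_count_space)

lemma sum_over_product4:
  "sum_over f1 * sum_over f2 * sum_over f3 * sum_over f4
    = sum_over (\<lambda>(n1::int, n2::int, n3::int, n4::int). f1 n1 * f2 n2 * f3 n3 * f4 n4)"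
  unfolding sum_over_quadruples by (simp add: nn_integral_cmult nn_integral_multc)

section \<open>The linear forms\<close>

lemma dotc_fvec:
  assumes "k < m"
  shows "dotc (2*m+1) (fvec m (4*k+1)) x = x (2*k+1)"
    and "dotc (2*m+1) (fvec m (4*k+2)) x = x (2*k+1) - x (2*k+2)"
    and "dotc (2*m+1) (fvec m (4*k+3)) x = x (2*k+2)"
    and "dotc (2*m+1) (fvec m (4*k+4)) x = x (2*k+2) - x (2*k+3)"
proof -
  have basis: "(\<Sum>i=1..2*m+1. complex_of_real (std_basis l i) * x i) = x l" if "l \<in> {1..2*m+1}" for l
    using that by (simp add: std_basis_def if_distrib[of complex_of_real] if_distrib[of "\<lambda>t. t * _"] cong: if_cong)
  have spoke: "dotc (2*m+1) (fvec m (2*l+1)) x = x (l+1)" if "l \<le> 2*m" for l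
  proof -
    have "fvec m (2*l+1) = std_basis (l + 1)" using that by (simp add: fvec_def)
    then show ?thesis unfolding dotc_def using basis[of "l + 1"] that by simp
  qed
  have path: "dotc (2*m+1) (fvec m (2*l+2)) x = x (l+1) - x (l+2)" if "l < 2*m" for l
  proof -
    have "fvec m (2*l+2) = (\<lambda>k. std_basis (l+1) k - std_basis (l+2) k)"
      using that by (simp add: fvec_def)
    then show ?thesis
      unfolding dotc_def using basis[of "l + 1"] basis[of "l + 2"] that
      by (simp add: left_diff_distrib sum_subtractf)
  qed
  have index: "2 * (2*k+1) + 1 = 4*k+3" "2 * (2*k+1) + 2 = 4*k+4" "2*k+1+1 = 2*k+2" "2*k+1+2 = 2*k+3"
    by simp_all
  show "dotc (2*m+1) (fvec m (4*k+1)) x = x (2*k+1)"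
    using spoke[of "2*k"] assms by simp
  show "dotc (2*m+1) (fvec m (4*k+3)) x = x (2*k+2)"
    using spoke[of "2*k+1", unfolded index] assms by simp
  show "dotc (2*m+1) (fvec m (4*k+2)) x = x (2*k+1) - x (2*k+2)"
    using path[of "2*k"] assms by simp
  show "dotc (2*m+1) (fvec m (4*k+4)) x = x (2*k+2) - x (2*k+3)"
    using path[of "2*k+1", unfolded index] assms by simp
qed

lemma dotc_fvec_last:
  "dotc (2*m+1) (fvec m (4*m+1)) x = x (2*m+1)"
  "dotc (2*m+1) (fvec m (4*m+2)) x = alt_sum (2*m+1) x"
proof -
  have "fvec m (4*m+1) = std_basis (2*m+1)" by (simp add: fvec_def)
  then show "dotc (2*m+1) (fvec m (4*m+1)) x = x (2*m+1)"
    by (simp add: dotc_def std_basis_def if_distrib[of complex_of_real] if_distrib[of "\<lambda>t. t * _"] cong: if_cong)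
  have "fvec m (4*m+2) k = (-1) ^ (k + 1)" if "k \<in> {1..2*m+1}" for k
    using that by (simp add: fvec_def std_basis_def if_distrib[of "\<lambda>t. _ * t"] cong: if_cong)
  then show "dotc (2*m+1) (fvec m (4*m+2)) x = alt_sum (2*m+1) x"
    unfolding dotc_def alt_sum_def by (intro sum.cong) auto
qed

lemma AE_lborel_affine:
  fixes t :: "'a::euclidean_space"
  assumes "AE z in lborel. P z" and c: "c \<noteq> 0"
  shows "AE y in lborel. P (t + c *\<^sub>R y)"
proof -
  obtain N where "{z \<in> space lborel. \<not> P z} \<subseteq> N" "emeasure lborel N = 0" "N \<in> sets lborel"
    by (rule AE_E[OF assms(1)])
  then have N: "{z. \<not> P z} \<subseteq> N" "N \<in> sets borel" "emeasure lborel N = 0" by simp_all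
  have "emeasure lborel N = (\<integral>\<^sup>+z. indicator N z \<partial>density (distr lborel borel (\<lambda>x::'a. t + c *\<^sub>R x)) (\<lambda>_. ennreal (\<bar>c\<bar>^DIM('a))))"
    using N(2) by (subst lborel_affine[OF c, of t]) simp
  also have "\<dots> = ennreal (\<bar>c\<bar>^DIM('a)) * (\<integral>\<^sup>+y. indicator N (t + c *\<^sub>R y) \<partial>lborel)"
    using N(2) by (simp add: nn_integral_density nn_integral_distr nn_integral_cmult del: nn_integral_indicator)
  finally have "(\<integral>\<^sup>+y. indicator N (t + c *\<^sub>R y) \<partial>lborel) = (0::ennreal)"
    using N(3) c by simp
  then have "AE y in lborel. indicator N (t + c *\<^sub>R y) = (0::ennreal)"
    using N(2) by (subst (asm) nn_integral_0_iff_AE) auto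
  then show ?thesis
  proof eventually_elim
    case (elim y)
    then show ?case using N(1) by (auto simp: indicator_eq_0_iff)
  qed
qed

lemma measurable_dotc: "dotc n f \<in> borel_measurable (Pi\<^sub>M {1..n} (\<lambda>_. lborel))"
  unfolding dotc_def by (intro borel_measurable_sum borel_measurable_times) (auto intro: coordinate_borel)

text \<open>Functions on \<open>\<complex>\<close> that agree almost everywhere give integrands that agree almost everywhere: the preimage of
  a null set under a nonzero linear form is a null set, by integrating first in a coordinate on which the
  form depends.\<close>

lemma AE_dotc:
  assumes P: "AE z in lborel. P z" and i: "i \<in> {1..n}" "f i \<noteq> 0"
  shows "AE x in Pi\<^sub>M {1..n} (\<lambda>_. lborel). P (dotc n f x)"
proof -
  interpret product_sigma_finite "\<lambda>_::nat. lborel :: complex measure" ..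
  obtain N where "{z \<in> space lborel. \<not> P z} \<subseteq> N" "emeasure lborel N = 0" "N \<in> sets lborel"
    by (rule AE_E[OF P])
  then have N: "{z. \<not> P z} \<subseteq> N" "N \<in> sets borel" "emeasure lborel N = 0" by simp_all
  define I where "I = {1..n} - {i}"
  have I: "{1..n} = insert i I" "finite I" "i \<notin> I" using i by (auto simp: I_def)
  have meas: "(\<lambda>x. indicator N (dotc n f x) :: ennreal) \<in> borel_measurable (Pi\<^sub>M (insert i I) (\<lambda>_. lborel))"
    unfolding I(1)[symmetric]
    by (rule measurable_compose[OF measurable_dotc borel_measurable_indicator[OF N(2)]])
  have split: "dotc n f (x(i := y)) = dotc n f (x(i := 0)) + f i *\<^sub>R y" for x y
    unfolding dotc_def I(1) using I(2,3)
    by (simp add: scaleR_conv_of_real) (rule sum.cong, auto)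
  have "(\<integral>\<^sup>+x. indicator N (dotc n f x) \<partial>Pi\<^sub>M {1..n} (\<lambda>_. lborel))
      = (\<integral>\<^sup>+x. \<integral>\<^sup>+y. indicator N (dotc n f (x(i := y))) \<partial>lborel \<partial>Pi\<^sub>M I (\<lambda>_. lborel))"
    unfolding I(1) by (rule product_nn_integral_insert[OF I(2,3) meas[unfolded I(1)]])
  also have "\<dots> = (\<integral>\<^sup>+x. 0 \<partial>Pi\<^sub>M I (\<lambda>_. lborel :: complex measure))"
  proof (rule nn_integral_cong)
    fix x
    have "AE z in lborel. z \<notin> N" using N(2,3) by (intro AE_not_in) (auto intro: null_setsI)
    from AE_lborel_affine[OF this i(2), of "dotc n f (x(i := 0))"]
    have "AE y in lborel. dotc n f (x(i := y)) \<notin> N"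
    proof eventually_elim
      case (elim y)
      then show ?case by (subst split)
    qed
    then have "AE y in lborel. indicator N (dotc n f (x(i := y))) = (0::ennreal)"
      by eventually_elim simp
    from nn_integral_cong_AE[OF this]
    show "(\<integral>\<^sup>+y. indicator N (dotc n f (x(i := y))) \<partial>lborel) = (0::ennreal)"
      by (simp only: nn_integral_const mult_zero_left)
  qed
  finally have "(\<integral>\<^sup>+x. indicator N (dotc n f x) \<partial>Pi\<^sub>M {1..n} (\<lambda>_. lborel)) = (0::ennreal)" by simp
  then have "AE x in Pi\<^sub>M {1..n} (\<lambda>_. lborel). indicator N (dotc n f x) = (0::ennreal)"
    using meas[folded I(1)] by (subst (asm) nn_integral_0_iff_AE) auto
  then show ?thesis
  proof eventually_elim
    case (elim y)
    then show ?case using N(1) by (auto simp: indicator_eq_0_iff)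
  qed
qed

lemma fvec_nonzero:
  assumes "j \<in> {1..4*m+2}"
  obtains i where "i \<in> {1..2*m+1}" "fvec m j i \<noteq> 0"
proof (cases "j = 4*m+2 \<or> odd j")
  case True
  show ?thesis
  proof (cases "j = 4*m+2")
    case True
    then have "fvec m j 1 \<noteq> 0"
      by (simp add: fvec_def std_basis_def if_distrib[of "\<lambda>t. _ * t"] cong: if_cong)
    then show ?thesis by (intro that[of 1]) auto
  next
    case False
    with \<open>j = 4*m+2 \<or> odd j\<close> have "odd j" by simp
    then have "fvec m j ((j + 1) div 2) \<noteq> 0" using False by (simp add: fvec_def std_basis_def)
    moreover have "(j + 1) div 2 \<in> {1..2*m+1}" using assms \<open>odd j\<close> by (auto elim!: oddE)
    ultimately show ?thesis by (rule that[rotated])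
  qed
next
  case False
  then have "fvec m j (j div 2) \<noteq> 0" by (simp add: fvec_def std_basis_def)
  moreover have "j div 2 \<in> {1..2*m+1}" using assms False by (auto elim!: evenE)
  ultimately show ?thesis by (rule that[rotated])
qed

lemma prod_blocks:
  "(\<Prod>j=1..4*m+2. t j) = (\<Prod>k<m. t (4*k+1) * t (4*k+2) * t (4*k+3) * t (4*k+4)) * (t (4*m+1) * t (4*m+2))"
  for t :: "nat \<Rightarrow> 'a::comm_monoid_mult"
proof -
  have "(\<Prod>j=1..4*m. t j) = (\<Prod>k<m. t (4*k+1) * t (4*k+2) * t (4*k+3) * t (4*k+4))"
    by (induction m) (simp_all add: mult.assoc eval_nat_numeral)
  then show ?thesis by (simp add: mult.assoc)
qed

text \<open>The functions are only Lebesgue measurable, so the preimages of null sets have to be null sets.\<close>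

lemma measurable_Lambda_integrand:
  assumes "\<And>j. j \<in> {1..4*m+2} \<Longrightarrow> a j \<in> borel_measurable lebesgue"
  shows "Lambda_integrand m a \<in> borel_measurable (lebesgue_Cn (2*m+1))"
proof -
  let ?M = "Pi\<^sub>M {1..2*m+1} (\<lambda>_. lborel :: complex measure)"
  have "dotc (2*m+1) (fvec m j) \<in> completion ?M \<rightarrow>\<^sub>M lebesgue" if j: "j \<in> {1..4*m+2}" for j
  proof (rule completion.measurable_completion2)
    show meas: "dotc (2*m+1) (fvec m j) \<in> completion ?M \<rightarrow>\<^sub>M lborel"
      using measurable_completion[OF measurable_dotc] by simp
    obtain i where i: "i \<in> {1..2*m+1}" "fvec m j i \<noteq> 0" by (rule fvec_nonzero[OF j])
    show "null_sets lborel \<subseteq> null_sets (distr (completion ?M) lborel (dotc (2*m+1) (fvec m j)))"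
    proof
      fix N :: "complex set" assume N: "N \<in> null_sets lborel"
      then have "AE z in lborel. z \<notin> N" by (rule AE_not_in)
      from AE_completion[OF AE_dotc[where P = "\<lambda>z. z \<notin> N" and f = "fvec m j" and i = i, OF this i]]
      have "AE x in completion ?M. dotc (2*m+1) (fvec m j) x \<notin> N" .
      then have "AE z in distr (completion ?M) lborel (dotc (2*m+1) (fvec m j)). z \<notin> N"
        using meas N by (subst AE_distr_iff) auto
      then show "N \<in> null_sets (distr (completion ?M) lborel (dotc (2*m+1) (fvec m j)))"
        using N by (subst (asm) AE_iff_null_sets[symmetric]) auto
    qed
  qed
  then show ?thesis
    unfolding Lambda_integrand_def lebesgue_Cn_def
    by (intro borel_measurable_prod measurable_compose[OF _ assms]) auto
qed

section \<open>Summation over the level sets of one block\<close>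

text \<open>Indices other than \<open>1, 2, 3\<close> give the last component; only \<open>1, \<dots>, 4\<close> are meant.\<close>

definition entry :: "int \<times> int \<times> int \<times> int \<Rightarrow> nat \<Rightarrow> int" where
  "entry \<nu> i = (case \<nu> of (n1, n2, n3, n4) \<Rightarrow> if i = 1 then n1 else if i = 2 then n2 else if i = 3 then n3 else n4)"

lemma entry_simps [simp]:
  "entry (n1, n2, n3, n4) (Suc 0) = n1" "entry (n1, n2, n3, n4) 2 = n2"
  "entry (n1, n2, n3, n4) 3 = n3" "entry (n1, n2, n3, n4) 4 = n4"
  by (simp_all add: entry_def)

lemma sum_1_to_4: "(\<Sum>i=1..4. f i) = f 1 + f 2 + f 3 + f (4::nat)"
  for f :: "nat \<Rightarrow> 'a::comm_monoid_add"
  by (simp add: eval_nat_numeral add.assoc)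

lemma prod_1_to_4: "(\<Prod>i=1..4. f i) = f 1 * f 2 * f 3 * f (4::nat)"
  for f :: "nat \<Rightarrow> 'a::comm_monoid_mult"
  by (simp add: eval_nat_numeral mult.assoc)

definition decay :: "real \<Rightarrow> int \<Rightarrow> ennreal" where
  "decay \<epsilon> k = ennreal (exp (- (\<epsilon> / 3) * \<bar>of_int k\<bar>))"

text \<open>The constant of one block as a function of \<open>M = 1/\<epsilon>\<close>. The factor \<open>exp 4\<close> is \<open>exp (2 * (\<tau>\<^sub>1 + \<tau>\<^sub>2 + \<tau>\<^sub>3 + \<tau>\<^sub>4))\<close>: a
  level set with index \<open>n\<close> has measure up to \<open>exp (n + 1)\<close>, but the sample with index \<open>n\<close> has the factor
  \<open>exp (\<tau> * (n - 1))\<close>.\<close>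

definition block_const :: "real \<Rightarrow> real" where
  "block_const M = exp 4 * enn2real (sum_over (decay (1 / M))) ^ 3"

lemma block_const_eq:
  assumes "0 < \<epsilon>"
  shows "ennreal (exp 4) * sum_over (decay \<epsilon>) ^ 3 = ennreal (block_const (1 / \<epsilon>))"
proof -
  have "sum_over (decay \<epsilon>) < \<infinity>"
    using geometric_sum_finite[of "\<epsilon> / 3"] assms by (simp add: decay_def)
  then have "sum_over (decay \<epsilon>) = ennreal (enn2real (sum_over (decay \<epsilon>)))" by (simp add: less_top)
  then have "ennreal (exp 4) * sum_over (decay \<epsilon>) ^ 3
      = ennreal (exp 4) * ennreal (enn2real (sum_over (decay \<epsilon>))) ^ 3" by simp
  also have "\<dots> = ennreal (exp 4 * enn2real (sum_over (decay \<epsilon>)) ^ 3)"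
    by (simp add: ennreal_mult ennreal_power)
  finally show ?thesis by (simp add: block_const_def)
qed

text \<open>What the restricted estimate gives for the level sets with indices \<open>\<nu>\<close>, times the heights \<open>d\<close> of these
  levels.\<close>

definition level_cost :: "real \<Rightarrow> (nat \<Rightarrow> real) \<Rightarrow> (nat \<Rightarrow> int \<Rightarrow> ennreal) \<Rightarrow> int \<times> int \<times> int \<times> int \<Rightarrow> ennreal" where
  "level_cost \<epsilon> \<tau> d \<nu> = d 1 (entry \<nu> 1) * d 2 (entry \<nu> 2) * d 3 (entry \<nu> 3) * d 4 (entry \<nu> 4)
     * ennreal (exp ((\<Sum>i=1..4. \<tau> i * (of_int (entry \<nu> i) + 1)) - \<epsilon> * spread (\<lambda>i. of_int (entry \<nu> i) + 1)))"

lemma sum_level_cost_le: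
  fixes d :: "nat \<Rightarrow> int \<Rightarrow> ennreal" and L :: "nat \<Rightarrow> ennreal" and b :: "nat \<Rightarrow> int \<Rightarrow> real"
  assumes \<epsilon>: "0 < \<epsilon>" and \<tau>: "\<tau> 1 + \<tau> 2 + \<tau> 3 + \<tau> 4 = (2::real)"
    and d: "\<And>i n. i \<in> {1..4} \<Longrightarrow> ennreal (exp (\<tau> i * (of_int n - 1))) * d i n = L i * ennreal (b i n)"
    and q: "\<And>i. i \<in> {1..4} \<Longrightarrow> 0 < q i" "1 \<le> (\<Sum>i=1..4. 1 / q i)"
    and b: "\<And>i. i \<in> {1..4} \<Longrightarrow> lq_bounded (q i) (b i)"
  shows "sum_over (level_cost \<epsilon> \<tau> d) \<le> ennreal (block_const (1 / \<epsilon>)) * (L 1 * L 2 * L 3 * L 4)"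
proof -
  let ?b = "\<lambda>i n. ennreal (b i n)"
  let ?C = "ennreal (exp 4) * (L 1 * L 2 * L 3 * L 4)"
  have factor: "level_cost \<epsilon> \<tau> d (n1, n2, n3, n4) = ?C * (decay \<epsilon> (n2 - n1) * decay \<epsilon> (n3 - n1) * decay \<epsilon> (n4 - n1)
      * (?b 1 n1 * ?b 2 n2 * ?b 3 n3 * ?b 4 n4))" for n1 n2 n3 n4
  proof -
    let ?e = "\<lambda>i n. exp (\<tau> i * (of_int n - 1))"
    let ?g = "\<lambda>k::int. exp (- (\<epsilon> / 3) * \<bar>of_int k\<bar>)"
    have "\<tau> 1 * (real_of_int n1 + 1) + \<tau> 2 * (real_of_int n2 + 1) + \<tau> 3 * (real_of_int n3 + 1) + \<tau> 4 * (real_of_int n4 + 1)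
        = \<tau> 1 * (real_of_int n1 - 1) + \<tau> 2 * (real_of_int n2 - 1) + \<tau> 3 * (real_of_int n3 - 1) + \<tau> 4 * (real_of_int n4 - 1)
          + 2 * (\<tau> 1 + \<tau> 2 + \<tau> 3 + \<tau> 4)"
      by (simp add: algebra_simps)
    then have "(\<Sum>i=1..4. \<tau> i * (of_int (entry (n1, n2, n3, n4) i) + 1)) - \<epsilon> * spread (\<lambda>i. of_int (entry (n1, n2, n3, n4) i) + 1)
        = \<tau> 1 * (real_of_int n1 - 1) + \<tau> 2 * (real_of_int n2 - 1) + \<tau> 3 * (real_of_int n3 - 1) + \<tau> 4 * (real_of_int n4 - 1)
          + 4 + - (\<epsilon> / 3) * \<bar>real_of_int (n2 - n1)\<bar> + - (\<epsilon> / 3) * \<bar>real_of_int (n3 - n1)\<bar> + - (\<epsilon> / 3) * \<bar>real_of_int (n4 - n1)\<bar>"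
      unfolding \<tau> sum_1_to_4 spread_def by (simp add: add_divide_distrib distrib_left)
    then have "exp ((\<Sum>i=1..4. \<tau> i * (of_int (entry (n1, n2, n3, n4) i) + 1)) - \<epsilon> * spread (\<lambda>i. of_int (entry (n1, n2, n3, n4) i) + 1))
        = ?e 1 n1 * ?e 2 n2 * ?e 3 n3 * ?e 4 n4 * exp 4 * ?g (n2 - n1) * ?g (n3 - n1) * ?g (n4 - n1)"
      by (simp only: exp_add)
    then have "level_cost \<epsilon> \<tau> d (n1, n2, n3, n4)
        = (ennreal (?e 1 n1) * d 1 n1) * (ennreal (?e 2 n2) * d 2 n2) * (ennreal (?e 3 n3) * d 3 n3) * (ennreal (?e 4 n4) * d 4 n4)
          * (ennreal (exp 4) * (decay \<epsilon> (n2 - n1) * decay \<epsilon> (n3 - n1) * decay \<epsilon> (n4 - n1)))"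
      unfolding level_cost_def by (simp add: ennreal_mult decay_def mult_ac)
    also have "\<dots> = (L 1 * ?b 1 n1) * (L 2 * ?b 2 n2) * (L 3 * ?b 3 n3) * (L 4 * ?b 4 n4)
          * (ennreal (exp 4) * (decay \<epsilon> (n2 - n1) * decay \<epsilon> (n3 - n1) * decay \<epsilon> (n4 - n1)))"
      by (subst (1 2 3 4) d) auto
    finally show ?thesis by (simp add: mult_ac)
  qed
  have shift: "(\<integral>\<^sup>+n. ?b 1 n * ?b 2 (n + k2) * ?b 3 (n + k3) * ?b 4 (n + k4) \<partial>count_space UNIV) \<le> 1" for k2 k3 k4
  proof -
    define s :: "nat \<Rightarrow> int" where "s = (\<lambda>i. if i = 2 then k2 else if i = 3 then k3 else if i = 4 then k4 else 0)"
    have "(\<Prod>i=1..4. ?b i (n + s i)) = ?b 1 n * ?b 2 (n + k2) * ?b 3 (n + k3) * ?b 4 (n + k4)" for n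
      unfolding prod_1_to_4 by (simp add: s_def)
    then show ?thesis
      using sum_prod_shift_le_1[of "{1..4}" q b s] q b by simp
  qed
  have "sum_over (level_cost \<epsilon> \<tau> d) = sum_over (\<lambda>(n1, n2, n3, n4). level_cost \<epsilon> \<tau> d (n1, n2, n3, n4))"
    by (simp add: case_prod_beta)
  also have "\<dots> = ?C * (\<integral>\<^sup>+n1. \<integral>\<^sup>+n2. \<integral>\<^sup>+n3. \<integral>\<^sup>+n4. decay \<epsilon> (n2 - n1) * decay \<epsilon> (n3 - n1) * decay \<epsilon> (n4 - n1)
      * (?b 1 n1 * ?b 2 n2 * ?b 3 n3 * ?b 4 n4)
      \<partial>count_space UNIV \<partial>count_space UNIV \<partial>count_space UNIV \<partial>count_space UNIV)"
    unfolding sum_over_quadruples factor by (simp only: nn_integral_cmult borel_measurable_count_space)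
  also have "\<dots> \<le> ?C * (sum_over (decay \<epsilon>) ^ 3 * 1)"
    by (intro mult_left_mono sum4_shift_decay shift) auto
  also have "\<dots> = (ennreal (exp 4) * sum_over (decay \<epsilon>) ^ 3) * (L 1 * L 2 * L 3 * L 4)"
    by (simp add: mult_ac)
  finally show ?thesis unfolding block_const_eq[OF \<epsilon>] .
qed

section \<open>The multilinear bound\<close>

text \<open>With Borel functions the theorem of Fubini for the uncompleted product measure applies.\<close>

lemma L_norm_borel_version:
  assumes a: "a \<in> borel_measurable lebesgue" and v: "0 < v" and fin: "L_norm v a < \<infinity>"
  obtains \<alpha> A where "\<alpha> \<in> borel_measurable borel" "\<And>z. 0 \<le> \<alpha> z" "AE z in lborel. cmod (a z) = \<alpha> z"
    and "(\<integral>\<^sup>+z. ennreal (\<alpha> z powr (1 / v)) \<partial>lborel) = ennreal A" "0 \<le> A" "L_norm v a = ennreal (A powr v)"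
proof -
  have "(\<lambda>z. cmod (a z)) \<in> borel_measurable (completion lborel)"
    by (rule measurable_compose[OF a borel_measurable_norm]) 
  from completion_ex_borel_measurable_real[OF this]
  obtain g where g: "g \<in> borel_measurable lborel" "AE z in lborel. cmod (a z) = g z" by (elim bexE)
  define \<alpha> where "\<alpha> z = \<bar>g z\<bar>" for z
  have \<alpha>: "\<alpha> \<in> borel_measurable borel"
    using g(1) unfolding \<alpha>_def by simp
  have AE: "AE z in lborel. cmod (a z) = \<alpha> z"
    using g(2) by eventually_elim (metis \<alpha>_def abs_norm_cancel)
  define I where "I = (\<integral>\<^sup>+z. ennreal (\<alpha> z powr (1 / v)) \<partial>lborel)"
  have "(\<integral>\<^sup>+z. ennreal (cmod (a z) powr (1 / v)) \<partial>lebesgue) = (\<integral>\<^sup>+z. ennreal (cmod (a z) powr (1 / v)) \<partial>lborel)"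
    by (rule nn_integral_completion)
  also have "\<dots> = I"
    unfolding I_def by (rule nn_integral_cong_AE) (use AE in eventually_elim, simp)
  finally have L: "L_norm v a = ennpowr I v" unfolding L_norm_def by simp
  have I: "I \<noteq> \<infinity>"
  proof
    assume "I = \<infinity>"
    then have "L_norm v a = \<infinity>" unfolding L by (simp add: ennpowr_def)
    with fin show False by simp
  qed
  then have "I = ennreal (enn2real I)" by (simp add: less_top)
  moreover have "L_norm v a = ennreal (enn2real I powr v)" using I unfolding L by (simp add: ennpowr_def)
  ultimately show ?thesis
    using \<alpha> AE by (intro that[of \<alpha> "enn2real I"]) (simp_all add: I_def \<alpha>_def)
qed

text \<open>The bound for the integral of the absolute value. It yields integrability and the estimate of the form
  at the same time.\<close>

lemma Lambda_integrand_nn_integral_le: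
  fixes \<theta> :: "nat \<Rightarrow> real" and q :: "nat \<Rightarrow> ennreal" and a :: "nat \<Rightarrow> complex \<Rightarrow> complex"
  defines "L \<equiv> \<lambda>j. lorentz_norm (\<theta> j) (q j) (a j)"
  assumes \<epsilon>: "0 < \<epsilon>" and near: "\<And>j. j \<in> {1..4*m+2} \<Longrightarrow> \<bar>\<theta> j - 1/2\<bar> + \<epsilon> \<le> 1/10"
    and blocks: "\<And>k. k < m \<Longrightarrow> (\<Sum>i=1..4. \<theta> (4*k+i)) = 2"
    and last: "\<theta> (4*m+1) + \<theta> (4*m+2) = 1"
    and q: "\<And>j. j \<in> {1..4*m} \<Longrightarrow> 0 < q j"
    and dual: "\<And>k. k < m \<Longrightarrow> 1 \<le> (\<Sum>i=1..4. 1 / q (4*k+i))"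
    and a: "\<And>j. j \<in> {1..4*m+2} \<Longrightarrow> a j \<in> borel_measurable lebesgue"
    and L: "\<And>j. j \<in> {1..4*m} \<Longrightarrow> L j < \<infinity>"
    and L_last: "\<And>j. j \<in> {4*m+1, 4*m+2} \<Longrightarrow> L_norm (\<theta> j) (a j) < \<infinity>"
  shows "(\<integral>\<^sup>+x. ennreal (cmod (Lambda_integrand m a x)) \<partial>Pi\<^sub>M {1..2*m+1} (\<lambda>_. lborel))
    \<le> ennreal (block_const (1 / \<epsilon>) ^ m) * L_norm (\<theta> (4*m+1)) (a (4*m+1)) * L_norm (\<theta> (4*m+2)) (a (4*m+2))
      * (\<Prod>k<m. L (4*k+1) * L (4*k+2) * L (4*k+3) * L (4*k+4))"
proof -
  let ?M = "Pi\<^sub>M {1..2*m+1} (\<lambda>_. lborel :: complex measure)"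
  let ?f = "\<lambda>j. dotc (2*m+1) (fvec m j)"
  define d where "d j n = decr_rearrangement (a j) (exp (of_int n))" for j n
  have pos: "0 < \<theta> j" if "j \<in> {1..4*m+2}" for j using near[OF that] \<epsilon> by linarith
  have range: "4*k+i \<in> {1..4*m}" if "k < m" "i \<in> {1..4}" for k i using that by auto

  \<comment> \<open>Outside of the blocks the level sets are empty, so that they have the required size for every index.\<close>
  have "\<exists>E. (\<forall>n. E n \<in> sets borel \<and> emeasure lborel (E n) \<le> ennreal (exp (of_int n + 1)))
      \<and> (j \<in> {1..4*m} \<longrightarrow> (AE z in lborel. ennreal (cmod (a j z)) \<le> sum_over (\<lambda>n. d j n * indicator (E n) z)))"
    for j
  proof (cases "j \<in> {1..4*m}")
    case True
    then have j: "j \<in> {1..4*m+2}" by simp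
    obtain E :: "int \<Rightarrow> complex set"
      where "\<And>n. E n \<in> sets borel" "\<And>n. emeasure lborel (E n) \<le> ennreal (exp (of_int n + 1))"
        "AE z in lborel. ennreal (cmod (a j z)) \<le> sum_over (\<lambda>n. decr_rearrangement (a j) (exp (of_int n)) * indicator (E n) z)"
      by (rule level_decomposition[OF a[OF j] pos[OF j] q[OF True] L[OF True, unfolded L_def]]) (rule that)
    then show ?thesis unfolding d_def by (intro exI[of _ E] conjI allI impI)
  next
    case False
    then show ?thesis by (intro exI[of _ "\<lambda>_. {}"] conjI allI impI) (simp, simp, erule notE)
  qed
  from choice[OF allI[OF this]] obtain E :: "nat \<Rightarrow> int \<Rightarrow> complex set" where
    "\<forall>j. (\<forall>n. E j n \<in> sets borel \<and> emeasure lborel (E j n) \<le> ennreal (exp (of_int n + 1)))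
      \<and> (j \<in> {1..4*m} \<longrightarrow> (AE z in lborel. ennreal (cmod (a j z)) \<le> sum_over (\<lambda>n. d j n * indicator (E j n) z)))" ..
  then have E: "E j n \<in> sets borel" "emeasure lborel (E j n) \<le> ennreal (exp (of_int n + 1))"
    and E_AE: "j \<in> {1..4*m} \<Longrightarrow> AE z in lborel. ennreal (cmod (a j z)) \<le> sum_over (\<lambda>n. d j n * indicator (E j n) z)" for j n
    by simp_all

  have "\<exists>b. j \<in> {1..4*m} \<longrightarrow> lq_bounded (q j) b \<and> (\<forall>n. sampled (\<theta> j) (a j) n = L j * ennreal (b n))" for j
  proof (cases "j \<in> {1..4*m}")
    case True
    then have "0 \<le> \<theta> j" using pos[of j] by simp
    obtain b where "lq_bounded (q j) b" "\<And>n. sampled (\<theta> j) (a j) n = L j * ennreal (b n)"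
      by (rule sampled_normalised[OF \<open>0 \<le> \<theta> j\<close> q[OF True] L[OF True, unfolded L_def]]) (simp add: L_def)
    then show ?thesis by (intro exI[of _ b]) simp
  next
    case False
    then show ?thesis by (intro exI[of _ "\<lambda>_. 0"] impI) (erule notE)
  qed
  from choice[OF allI[OF this]] obtain b where
    "\<forall>j. j \<in> {1..4*m} \<longrightarrow> lq_bounded (q j) (b j) \<and> (\<forall>n. sampled (\<theta> j) (a j) n = L j * ennreal (b j n))" ..
  then have b: "lq_bounded (q j) (b j)" "sampled (\<theta> j) (a j) n = L j * ennreal (b j n)" if "j \<in> {1..4*m}" for j n
    using that by simp_all

  have j1: "4*m+1 \<in> {1..4*m+2}" and j2: "4*m+2 \<in> {1..4*m+2}" by simp_all
  obtain \<alpha> A where \<alpha>: "\<alpha> \<in> borel_measurable borel" "\<And>z. 0 \<le> \<alpha> z" "AE z in lborel. cmod (a (4*m+1) z) = \<alpha> z"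
    and A: "(\<integral>\<^sup>+z. ennreal (\<alpha> z powr (1 / \<theta> (4*m+1))) \<partial>lborel) = ennreal A" "0 \<le> A"
      "L_norm (\<theta> (4*m+1)) (a (4*m+1)) = ennreal (A powr \<theta> (4*m+1))"
    by (rule L_norm_borel_version[OF a[OF j1] pos[OF j1] L_last]) simp_all
  obtain \<beta> B where \<beta>: "\<beta> \<in> borel_measurable borel" "\<And>z. 0 \<le> \<beta> z" "AE z in lborel. cmod (a (4*m+2) z) = \<beta> z"
    and B: "(\<integral>\<^sup>+z. ennreal (\<beta> z powr (1 / \<theta> (4*m+2))) \<partial>lborel) = ennreal B" "0 \<le> B"
      "L_norm (\<theta> (4*m+2)) (a (4*m+2)) = ennreal (B powr \<theta> (4*m+2))"
    by (rule L_norm_borel_version[OF a[OF j2] pos[OF j2] L_last]) simp_all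

  define D where "D k \<nu> = d (4*k+1) (entry \<nu> 1) * d (4*k+2) (entry \<nu> 2) * d (4*k+3) (entry \<nu> 3) * d (4*k+4) (entry \<nu> 4)" for k \<nu>
  define F where "F k \<nu> i = E (4*k+i) (entry \<nu> i)" for k \<nu> i
  define P where "P k \<nu> x = D k \<nu> * block (F k \<nu>) (x (2*k+1)) (x (2*k+2)) (x (2*k+3))" for k \<nu> and x :: "nat \<Rightarrow> complex"
  define h where "h x = ennreal (\<alpha> (x (2*m+1))) * ennreal (\<beta> (alt_sum (2*m+1) x))" for x :: "nat \<Rightarrow> complex"
  define N where "N k = level_cost \<epsilon> (\<lambda>i. \<theta> (4*k+i)) (\<lambda>i. d (4*k+i))" for k

  have pull: "AE x in ?M. Q (?f j x)" if Q: "AE z in lborel. Q z" and j: "j \<in> {1..4*m+2}" for Q j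
  proof -
    obtain i where "i \<in> {1..2*m+1}" "fvec m j i \<noteq> 0" by (rule fvec_nonzero[OF j])
    then show ?thesis by (rule AE_dotc[where P = Q and f = "fvec m j" and i = i, OF Q])
  qed
  have "AE x in ?M. ennreal (cmod (a j (?f j x))) \<le> sum_over (\<lambda>n. d j n * indicator (E j n) (?f j x))"
    if "j \<in> {1..4*m}" for j
    by (rule pull[where Q = "\<lambda>z. ennreal (cmod (a j z)) \<le> sum_over (\<lambda>n. d j n * indicator (E j n) z)",
          OF E_AE[OF that]]) (use that in simp)
  then have "AE x in ?M. \<forall>j\<in>{1..4*m}. ennreal (cmod (a j (?f j x))) \<le> sum_over (\<lambda>n. d j n * indicator (E j n) (?f j x))"
    by (rule AE_finite_allI[OF finite_atLeastAtMost])
  moreover have "AE x in ?M. cmod (a (4*m+1) (?f (4*m+1) x)) = \<alpha> (?f (4*m+1) x)"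
    by (rule pull[where Q = "\<lambda>z. cmod (a (4*m+1) z) = \<alpha> z", OF \<alpha>(3) j1])
  moreover have "AE x in ?M. cmod (a (4*m+2) (?f (4*m+2) x)) = \<beta> (?f (4*m+2) x)"
    by (rule pull[where Q = "\<lambda>z. cmod (a (4*m+2) z) = \<beta> z", OF \<beta>(3) j2])
  ultimately have dominated: "AE x in ?M. ennreal (cmod (Lambda_integrand m a x)) \<le> (\<Prod>k<m. sum_over (\<lambda>\<nu>. P k \<nu> x)) * h x"
  proof eventually_elim
    case (elim x)
    let ?t = "\<lambda>j. ennreal (cmod (a j (?f j x)))" and ?s = "\<lambda>j. sum_over (\<lambda>n. d j n * indicator (E j n) (?f j x))"
    have "ennreal (cmod (Lambda_integrand m a x)) = (\<Prod>j=1..4*m+2. ?t j)"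
      unfolding Lambda_integrand_def by (simp only: prod_ennreal norm_ge_zero prod_norm)
    also have "\<dots> = (\<Prod>k<m. ?t (4*k+1) * ?t (4*k+2) * ?t (4*k+3) * ?t (4*k+4)) * (?t (4*m+1) * ?t (4*m+2))"
      by (rule prod_blocks)
    also have "?t (4*m+1) * ?t (4*m+2) = h x"
      unfolding elim(2,3) unfolding h_def dotc_fvec_last ..
    also have "(\<Prod>k<m. ?t (4*k+1) * ?t (4*k+2) * ?t (4*k+3) * ?t (4*k+4)) * h x
        \<le> (\<Prod>k<m. sum_over (\<lambda>\<nu>. P k \<nu> x)) * h x"
    proof (rule mult_right_mono)
      show "(\<Prod>k<m. ?t (4*k+1) * ?t (4*k+2) * ?t (4*k+3) * ?t (4*k+4)) \<le> (\<Prod>k<m. sum_over (\<lambda>\<nu>. P k \<nu> x))"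
      proof (rule prod_mono_ennreal)
        fix k assume "k \<in> {..<m}"
        then have k: "k < m" by simp
        have "?t (4*k+1) * ?t (4*k+2) * ?t (4*k+3) * ?t (4*k+4) \<le> ?s (4*k+1) * ?s (4*k+2) * ?s (4*k+3) * ?s (4*k+4)"
          using k by (intro mult_mono elim(1)[rule_format]) auto
        also have "\<dots> = sum_over (\<lambda>\<nu>. P k \<nu> x)"
          unfolding sum_over_product4 dotc_fvec[OF k]
        proof (rule nn_integral_cong)
          fix \<nu> :: "int \<times> int \<times> int \<times> int"
          obtain n1 n2 n3 n4 where \<nu>: "\<nu> = (n1, n2, n3, n4)" by (cases \<nu>)
          show "(case \<nu> of (n1, n2, n3, n4) \<Rightarrow>
              d (4*k+1) n1 * indicator (E (4*k+1) n1) (x (2*k+1))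
              * (d (4*k+2) n2 * indicator (E (4*k+2) n2) (x (2*k+1) - x (2*k+2)))
              * (d (4*k+3) n3 * indicator (E (4*k+3) n3) (x (2*k+2)))
              * (d (4*k+4) n4 * indicator (E (4*k+4) n4) (x (2*k+2) - x (2*k+3)))) = P k \<nu> x"
            unfolding \<nu> P_def D_def F_def block_def by (simp add: mult_ac)
        qed
        finally show "?t (4*k+1) * ?t (4*k+2) * ?t (4*k+3) * ?t (4*k+4) \<le> sum_over (\<lambda>\<nu>. P k \<nu> x)" .
      qed
    qed simp
    finally show ?case .
  qed

  have coord: "(\<lambda>x. x i) \<in> borel_measurable ?M" if "i \<in> {1..2*m+1}" for i
    using coordinate_borel[OF that] .
  have P_meas: "P k \<nu> \<in> borel_measurable ?M" if "k < m" for k \<nu>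
    unfolding P_def using that
    by (intro borel_measurable_times_ennreal borel_measurable_const measurable_block coord allI) (auto simp: F_def E)
  have h_meas: "h \<in> borel_measurable ?M"
    unfolding h_def
    by (intro borel_measurable_times_ennreal measurable_compose[OF _ measurable_ennreal]
        measurable_compose[OF coord \<alpha>(1)] measurable_compose[OF measurable_alt_sum \<beta>(1)]) auto
  \<comment> \<open>the restricted estimate for one choice \<open>\<nu>\<close> of level sets in all blocks\<close>
  have cell: "(\<integral>\<^sup>+x. (\<Prod>k<m. P k (\<nu> k) x) * h x \<partial>?M)
      \<le> ennreal (A powr \<theta> (4*m+1) * B powr \<theta> (4*m+2)) * (\<Prod>k<m. N k (\<nu> k))" for \<nu>
  proof -
    let ?Q = "\<lambda>x. \<Prod>k<m. block (F k (\<nu> k)) (x (2*k+1)) (x (2*k+2)) (x (2*k+3))"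
    have Q: "?Q \<in> borel_measurable ?M"
      by (intro borel_measurable_prod_ennreal measurable_block coord allI) (auto simp: F_def E)
    have "(\<integral>\<^sup>+x. (\<Prod>k<m. P k (\<nu> k) x) * h x \<partial>?M) = (\<integral>\<^sup>+x. (\<Prod>k<m. D k (\<nu> k)) * (?Q x * h x) \<partial>?M)"
      by (simp only: P_def prod.distrib mult.assoc)
    also have "\<dots> = (\<Prod>k<m. D k (\<nu> k)) * chain_form m (\<lambda>k. F k (\<nu> k)) (\<lambda>x t. ennreal (\<alpha> x) * ennreal (\<beta> t))"
      unfolding chain_form_def h_def[symmetric]
      by (rule nn_integral_cmult) (intro borel_measurable_times_ennreal Q h_meas)
    also have "\<dots> \<le> (\<Prod>k<m. D k (\<nu> k)) * (ennreal (A powr \<theta> (4*m+1) * B powr \<theta> (4*m+2))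
       * (\<Prod>k<m. ennreal (exp ((\<Sum>i=1..4. \<theta> (4*k+i) * (of_int (entry (\<nu> k) i) + 1))
            - \<epsilon> * spread (\<lambda>i. of_int (entry (\<nu> k) i) + 1)))))"
    proof (intro mult_left_mono chain_form_elementary_le[where n = "\<lambda>k i. of_int (entry (\<nu> k) i) + 1"
          and \<tau> = "\<lambda>k i. \<theta> (4*k+i)"])
      show "\<theta> (4*k+1) + \<theta> (4*k+2) + \<theta> (4*k+3) + \<theta> (4*k+4) = 2" if "k < m" for k
        using blocks[OF that] unfolding sum_1_to_4 .
      show "\<bar>\<theta> (4*k+i) - 1/2\<bar> + \<epsilon> \<le> 1/10" if "k < m" "i \<in> {1..4}" for k i
        using that by (intro near) auto
      show "2/5 \<le> \<theta> (4*m+1)" "\<theta> (4*m+1) \<le> 3/5" using near[OF j1] \<epsilon> by linarith+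
    qed (use \<epsilon> in \<open>auto simp only: F_def E \<alpha>(1,2) \<beta>(1,2) A(1,2) B(1,2) last zero_le\<close>)
    also have "\<dots> = ennreal (A powr \<theta> (4*m+1) * B powr \<theta> (4*m+2)) * (\<Prod>k<m. N k (\<nu> k))"
      by (simp only: N_def level_cost_def D_def prod.distrib) (simp only: mult_ac)
    finally show ?thesis .
  qed
  have N_sum: "sum_over (N k) \<le> ennreal (block_const (1 / \<epsilon>)) * (L (4*k+1) * L (4*k+2) * L (4*k+3) * L (4*k+4))"
    if k: "k < m" for k
    unfolding N_def
  proof (rule sum_level_cost_le[OF \<epsilon>])
    show "\<theta> (4*k+1) + \<theta> (4*k+2) + \<theta> (4*k+3) + \<theta> (4*k+4) = 2"
      using blocks[OF k] unfolding sum_1_to_4 .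
    fix i :: nat assume "i \<in> {1..4}"
    note j = range[OF k this]
    show "ennreal (exp (\<theta> (4*k+i) * (of_int n - 1))) * d (4*k+i) n = L (4*k+i) * ennreal (b (4*k+i) n)" for n
      using b(2)[OF j, of n] unfolding sampled_def d_def .
    show "0 < q (4*k+i)" by (rule q[OF j])
    show "lq_bounded (q (4*k+i)) (b (4*k+i))" by (rule b(1)[OF j])
  qed (rule dual[OF k])
  have "(\<integral>\<^sup>+x. ennreal (cmod (Lambda_integrand m a x)) \<partial>?M) \<le> (\<integral>\<^sup>+x. (\<Prod>k<m. sum_over (\<lambda>\<nu>. P k \<nu> x)) * h x \<partial>?M)"
    by (rule nn_integral_mono_AE[OF dominated])
  also have "\<dots> \<le> ennreal (A powr \<theta> (4*m+1) * B powr \<theta> (4*m+2)) * (\<Prod>k<m. sum_over (N k))"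
    by (rule nn_integral_prod_sum_over_le[OF P_meas h_meas cell])
  also have "\<dots> \<le> ennreal (A powr \<theta> (4*m+1) * B powr \<theta> (4*m+2))
      * (\<Prod>k<m. ennreal (block_const (1 / \<epsilon>)) * (L (4*k+1) * L (4*k+2) * L (4*k+3) * L (4*k+4)))"
    by (intro mult_left_mono prod_mono_ennreal N_sum) auto
  also have "\<dots> = ennreal (block_const (1 / \<epsilon>) ^ m) * L_norm (\<theta> (4*m+1)) (a (4*m+1)) * L_norm (\<theta> (4*m+2)) (a (4*m+2))
      * (\<Prod>k<m. L (4*k+1) * L (4*k+2) * L (4*k+3) * L (4*k+4))"
  proof -
    have "0 \<le> block_const (1 / \<epsilon>)" by (simp add: block_const_def)
    then show ?thesis
      unfolding A(3) B(3) prod.distrib[of "\<lambda>_. ennreal (block_const (1 / \<epsilon>))"]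
      by (simp add: ennreal_mult ennreal_power mult_ac)
  qed
  finally show ?thesis .
qed

theorem theorem3p8:
  shows "\<exists>c :: real \<Rightarrow> real.
    \<forall>(m :: nat) (\<delta> :: real) (\<theta> :: nat \<Rightarrow> real) (q :: nat \<Rightarrow> ennreal) (a :: nat \<Rightarrow> complex \<Rightarrow> complex).
      0 < \<delta> \<longrightarrow> \<delta> \<le> 1 / 10 \<longrightarrow> \<theta> \<in> P_interior m \<delta> \<longrightarrow>
      (\<forall>i\<in>{1..4 * m}. 0 < q i) \<longrightarrow>
      (\<forall>k<m. (\<Sum>j=1..4. 1 / q (4 * k + j)) \<ge> 1) \<longrightarrow>
      (\<forall>i\<in>{1..4 * m + 2}. a i \<in> borel_measurable lebesgue) \<longrightarrow>
      (\<forall>i\<in>{1..4 * m}. lorentz_norm (\<theta> i) (q i) (a i) < \<infinity>) \<longrightarrow>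
      (\<forall>i\<in>{4 * m + 1, 4 * m + 2}. L_norm (\<theta> i) (a i) < \<infinity>) \<longrightarrow>
      integrable (lebesgue_Cn (2 * m + 1)) (Lambda_integrand m a) \<and>
      ennreal (cmod (Lambda_form m a)) \<le>
        ennreal (c (Max ((\<lambda>i. 1 / (1 / 10 - \<bar>\<theta> i - 1 / 2\<bar>)) ` {1..4 * m + 2})) ^ m)
        * L_norm (\<theta> (4 * m + 1)) (a (4 * m + 1))
        * L_norm (\<theta> (4 * m + 2)) (a (4 * m + 2))
        * (\<Prod>j<m.
             lorentz_norm (\<theta> (4 * j + 1)) (q (4 * j + 1)) (a (4 * j + 1))
             * lorentz_norm (\<theta> (4 * j + 2)) (q (4 * j + 2)) (a (4 * j + 2))
             * lorentz_norm (\<theta> (4 * j + 3)) (q (4 * j + 3)) (a (4 * j + 3))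
             * lorentz_norm (\<theta> (4 * j + 4)) (q (4 * j + 4)) (a (4 * j + 4)))"
proof (rule exI[of _ block_const], intro allI impI)
  fix m :: nat and \<delta> :: real and \<theta> :: "nat \<Rightarrow> real" and q :: "nat \<Rightarrow> ennreal" and a :: "nat \<Rightarrow> complex \<Rightarrow> complex"
  assume \<delta>: "0 < \<delta>" "\<delta> \<le> 1/10" and \<theta>: "\<theta> \<in> P_interior m \<delta>" and q: "\<forall>i\<in>{1..4*m}. 0 < q i"
    and dual: "\<forall>k<m. (\<Sum>j=1..4. 1 / q (4 * k + j)) \<ge> 1"
    and a: "\<forall>i\<in>{1..4*m+2}. a i \<in> borel_measurable lebesgue"
    and fin: "\<forall>i\<in>{1..4*m}. lorentz_norm (\<theta> i) (q i) (a i) < \<infinity>"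
    and fin_last: "\<forall>i\<in>{4*m+1, 4*m+2}. L_norm (\<theta> i) (a i) < \<infinity>"
  let ?X = "Max ((\<lambda>i. 1 / (1 / 10 - \<bar>\<theta> i - 1 / 2\<bar>)) ` {1..4 * m + 2})"
  let ?L = "\<lambda>j. lorentz_norm (\<theta> j) (q j) (a j)"
  let ?R = "ennreal (block_const ?X ^ m) * L_norm (\<theta> (4*m+1)) (a (4*m+1)) * L_norm (\<theta> (4*m+2)) (a (4*m+2))
      * (\<Prod>j<m. ?L (4*j+1) * ?L (4*j+2) * ?L (4*j+3) * ?L (4*j+4))"
  have \<theta>': "\<theta> \<in> P_affine m" "\<And>i. i \<in> {1..4*m+2} \<Longrightarrow> \<bar>\<theta> i - 1/2\<bar> < \<delta>"
    using \<theta> unfolding P_interior_eq by simp_all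
  have blocks: "(\<Sum>i=1..4. \<theta> (4*k+i)) = 2" if "k < m" for k
  proof -
    have "(\<Sum>i=1..4. \<theta> (4*k+i)) = (\<Sum>i=4*k+1..4*k+4. \<theta> i)"
      using sum.shift_bounds_cl_nat_ivl[of \<theta> 1 "4*k" 4] by (simp add: add.commute)
    then show ?thesis using \<theta>'(1) that by (simp add: P_affine_def)
  qed
  have last: "\<theta> (4*m+1) + \<theta> (4*m+2) = 1" using \<theta>'(1) by (simp add: P_affine_def)
  have gap: "0 < 1/10 - \<bar>\<theta> i - 1/2\<bar>" if "i \<in> {1..4*m+2}" for i using \<theta>'(2)[OF that] \<delta> by linarith
  have le_X: "1 / (1/10 - \<bar>\<theta> i - 1/2\<bar>) \<le> ?X" if "i \<in> {1..4*m+2}" for i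
    using that by (intro Max_ge) auto
  have one: "1 \<in> {1..4*m+2}" by simp
  have X: "0 < ?X" using le_X[OF one] gap[OF one] by (meson divide_pos_pos less_le_trans zero_less_one)
  have near: "\<bar>\<theta> i - 1/2\<bar> + 1 / ?X \<le> 1/10" if "i \<in> {1..4*m+2}" for i
  proof -
    have "1 / x \<le> g" if "1 / g \<le> x" "0 < g" "0 < x" for g x :: real
      using that by (simp add: divide_le_eq mult.commute)
    from this[OF le_X[OF that] gap[OF that] X]
    show ?thesis by linarith
  qed
  have "(\<integral>\<^sup>+x. ennreal (cmod (Lambda_integrand m a x)) \<partial>Pi\<^sub>M {1..2*m+1} (\<lambda>_. lborel))
      \<le> ennreal (block_const (1 / (1 / ?X)) ^ m) * L_norm (\<theta> (4*m+1)) (a (4*m+1)) * L_norm (\<theta> (4*m+2)) (a (4*m+2))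
      * (\<Prod>j<m. ?L (4*j+1) * ?L (4*j+2) * ?L (4*j+3) * ?L (4*j+4))"
    using X near blocks last q dual a fin fin_last
    by (intro Lambda_integrand_nn_integral_le) (simp_all only: zero_less_divide_1_iff)
  then have bound: "(\<integral>\<^sup>+x. ennreal (cmod (Lambda_integrand m a x)) \<partial>lebesgue_Cn (2*m+1)) \<le> ?R"
    unfolding lebesgue_Cn_def nn_integral_completion by (simp only: div_by_1 divide_divide_eq_right mult_1)
  have prod_finite: "(\<Prod>j<n. f j) < \<infinity>" if "\<And>j. j < n \<Longrightarrow> f j < \<infinity>" for f :: "nat \<Rightarrow> ennreal" and n
    using that by (induction n) (simp_all add: ennreal_mult_less_top)
  have "?L (4*j+1) * ?L (4*j+2) * ?L (4*j+3) * ?L (4*j+4) < \<infinity>" if "j < m" for j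
    using fin that by (simp add: ennreal_mult_less_top)
  then have "(\<Prod>j<m. ?L (4*j+1) * ?L (4*j+2) * ?L (4*j+3) * ?L (4*j+4)) < \<infinity>"
    by (rule prod_finite)
  moreover have "L_norm (\<theta> (4*m+1)) (a (4*m+1)) < \<infinity>" "L_norm (\<theta> (4*m+2)) (a (4*m+2)) < \<infinity>"
    using fin_last by simp_all
  ultimately have "?R < \<infinity>"
    by (simp only: ennreal_mult_less_top infinity_ennreal_def ennreal_less_top simp_thms)
  then have int: "integrable (lebesgue_Cn (2*m+1)) (Lambda_integrand m a)"
    using bound a by (intro integrableI_bounded measurable_Lambda_integrand) (auto intro: le_less_trans)
  have "ennreal (cmod (Lambda_form m a)) \<le> (\<integral>\<^sup>+x. ennreal (cmod (Lambda_integrand m a x)) \<partial>lebesgue_Cn (2*m+1))"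
    unfolding Lambda_form_def by (rule integral_norm_bound_ennreal[OF int])
  also note bound
  finally show "integrable (lebesgue_Cn (2 * m + 1)) (Lambda_integrand m a) \<and> ennreal (cmod (Lambda_form m a)) \<le> ?R"
    using int by blast
qed

end
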